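(* Let $\mathbf{Meas}$ be the category of sets equipped with $\sigma$-algebras and functions whose inverse images preserve measurable subsets. Then $\mathbf{Meas}$ has a noetherian form with complete algebraic modular fibres, inducing the factorization system whose left class consists of the surjective measurable maps and whose right class consists of the injective measurable maps whose domains carry the trace $\sigma$-algebras from their codomains.
   Context: An injective measurable map $m:A\to X$ has domain carrying the trace $\sigma$-algebra when the measurable subsets of $A$ are exactly the sets $m^{-1}(B)$ with $B$ measurable in $X$. A complete lattice is algebraic when each element is a join of compact elements. Conventions: categories are locally small; "set" is relative to a fixed universe. A proper factorization system $(\mathcal E,\mathcal M)$ is an orthogonal factorization system with every morphism in $\mathcal E$ an epimorphism and every morphism in $\mathcal M$ a monomorphism. Forms. An (orean) form $\mathsf F$ on a category $\mathcal C$ assigns to each object $X$ a set-sized bounded lattice $\mathsf F(X)$ (the fibre over $X$; its elements are called clusters) and to each morphism $f:X\to Y$ monotone maps $f_!:\mathsf F(X)\to\mathsf F(Y)$ and $f^*:\mathsf F(Y)\to\mathsf F(X)$ with $f_!S\le T\iff S\le f^*T$, such that $(gf)_!=g_!f_!$, $(gf)^*=f^*g^*$, and identities act as identities. Put $\operatorname{Im}f=f_!\top_X$ and $\operatorname{Ker}f=f^*\bot_Y$. A cluster in $\mathsf F(X)$ is conormal if it is the image of some morphism of $\mathcal C$ with codomain $X$, and normal if it is the kernel of some morphism of $\mathcal C$ with domain $X$. An embedding of a conormal $S\in\mathsf F(X)$ is a morphism $\iota$ into $X$ with $\operatorname{Im}\iota=S$ such that every morphism $f$ into $X$ with $\operatorname{Im}f\le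 S$ factors as $f=\iota h$ for a unique $h$. A quotient of a normal $K\in\mathsf F(X)$ is a morphism $\pi$ out of $X$ with $\operatorname{Ker}\pi=K$ such that every morphism $g$ out of $X$ with $K\le\operatorname{Ker}g$ factors as $g=h\pi$ for a unique $h$. The form is noetherian if: (N1) $f^*f_!S=S\vee\operatorname{Ker}f$ and $f_!f^*T=T\wedge\operatorname{Im}f$ for all $f,S,T$; (N2) every morphism $f$ factors as $f=me$ with $e$ a quotient of $\operatorname{Ker}f$ and $m$ an embedding of $\operatorname{Im}f$; (N3) the join of two normal clusters (in the same fibre) is normal, and the meet of two conormal clusters is conormal. For a noetherian form, the class of all quotients (of normal clusters) and the class of all embeddings (of conormal clusters) form a proper factorization system, the one induced by the form (quotients as left class, embeddings as right class). *)

theory Defs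
  imports
    "HOL-Analysis.Sigma_Algebra"
    "HOL-Library.FuncSet"
    "HOL-Algebra.Complete_Lattice"
begin

section \<open>The universe of sets\<close>

text \<open>A Grothendieck universe containing an infinite set. The type variable is the
  collection of all sets of the universe and \<open>elts x\<close> is the set of elements of \<open>x\<close>.
  Transitivity of the universe is built into the type of \<open>elts\<close>.\<close>

locale grothendieck_universe =
  fixes elts :: "'u \<Rightarrow> 'u set"
  assumes extensional: "inj elts"
    and subset_ex: "A \<subseteq> elts x \<Longrightarrow> \<exists>y. elts y = A"
    and pair_ex: "\<exists>p. elts p = {x, y}"
    and power_ex: "\<exists>p. elts p = {y. elts y \<subseteq> elts x}"
    and Union_ex: "\<And>f :: 'u \<Rightarrow> 'u. \<exists>u. elts u = (\<Union>i\<in>elts x. elts (f i))"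
    and infinite_ex: "\<exists>x. infinite (elts x)"

text \<open>The subsets of the universe that are themselves sets of the universe.\<close>

definition small :: "('u \<Rightarrow> 'u set) \<Rightarrow> 'u set \<Rightarrow> bool" where
  "small elts A \<longleftrightarrow> A \<in> range elts"


section \<open>Categories and factorization systems\<close>

text \<open>\<open>Comp C g f\<close> is the composite \<open>g f\<close>; it is meaningful only when
  \<open>Cod C f = Dom C g\<close>.\<close>

record ('o, 'm) cat =
  Obj :: "'o set"
  Arr :: "'m set"
  Dom :: "'m \<Rightarrow> 'o"
  Cod :: "'m \<Rightarrow> 'o"
  Id :: "'o \<Rightarrow> 'm"
  Comp :: "'m \<Rightarrow> 'm \<Rightarrow> 'm"

definition Hom :: "('o, 'm) cat \<Rightarrow> 'o \<Rightarrow> 'o \<Rightarrow> 'm set" where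
  "Hom C X Y = {f \<in> Arr C. Dom C f = X \<and> Cod C f = Y}"

locale category =
  fixes C :: "('o, 'm) cat"
  assumes Dom_Obj: "f \<in> Arr C \<Longrightarrow> Dom C f \<in> Obj C"
    and Cod_Obj: "f \<in> Arr C \<Longrightarrow> Cod C f \<in> Obj C"
    and Id_Hom: "X \<in> Obj C \<Longrightarrow> Id C X \<in> Hom C X X"
    and Comp_Hom: "f \<in> Hom C X Y \<Longrightarrow> g \<in> Hom C Y Z \<Longrightarrow> Comp C g f \<in> Hom C X Z"
    and Comp_Id: "f \<in> Hom C X Y \<Longrightarrow> Comp C f (Id C X) = f"
    and Id_Comp: "f \<in> Hom C X Y \<Longrightarrow> Comp C (Id C Y) f = f"
    and Comp_assoc: "f \<in> Hom C W X \<Longrightarrow> g \<in> Hom C X Y \<Longrightarrow> h \<in> Hom C Y Z \<Longrightarrow>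
      Comp C h (Comp C g f) = Comp C (Comp C h g) f"

definition is_iso :: "('o, 'm) cat \<Rightarrow> 'm \<Rightarrow> bool" where
  "is_iso C f \<longleftrightarrow> f \<in> Arr C \<and>
     (\<exists>g \<in> Hom C (Cod C f) (Dom C f).
        Comp C g f = Id C (Dom C f) \<and> Comp C f g = Id C (Cod C f))"

definition is_epi :: "('o, 'm) cat \<Rightarrow> 'm \<Rightarrow> bool" where
  "is_epi C f \<longleftrightarrow> f \<in> Arr C \<and>
     (\<forall>Z. \<forall>g \<in> Hom C (Cod C f) Z. \<forall>h \<in> Hom C (Cod C f) Z.
        Comp C g f = Comp C h f \<longrightarrow> g = h)"

definition is_mono :: "('o, 'm) cat \<Rightarrow> 'm \<Rightarrow> bool" where
  "is_mono C f \<longleftrightarrow> f \<in> Arr C \<and>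
     (\<forall>W. \<forall>g \<in> Hom C W (Dom C f). \<forall>h \<in> Hom C W (Dom C f).
        Comp C f g = Comp C f h \<longrightarrow> g = h)"

definition orthogonal :: "('o, 'm) cat \<Rightarrow> 'm \<Rightarrow> 'm \<Rightarrow> bool" where
  "orthogonal C e m \<longleftrightarrow>
     (\<forall>u \<in> Hom C (Dom C e) (Dom C m). \<forall>v \<in> Hom C (Cod C e) (Cod C m).
        Comp C v e = Comp C m u \<longrightarrow>
        (\<exists>!d. d \<in> Hom C (Cod C e) (Dom C m) \<and> Comp C d e = u \<and> Comp C m d = v))"

definition proper_factorization_system :: "('o, 'm) cat \<Rightarrow> 'm set \<Rightarrow> 'm set \<Rightarrow> bool" where
  "proper_factorization_system C E M \<longleftrightarrow>
     E \<subseteq> Arr C \<and> M \<subseteq> Arr C \<and>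
     {f. is_iso C f} \<subseteq> E \<and> {f. is_iso C f} \<subseteq> M \<and>
     (\<forall>f \<in> E. \<forall>g \<in> E. Cod C f = Dom C g \<longrightarrow> Comp C g f \<in> E) \<and>
     (\<forall>f \<in> M. \<forall>g \<in> M. Cod C f = Dom C g \<longrightarrow> Comp C g f \<in> M) \<and>
     (\<forall>f \<in> Arr C. \<exists>e \<in> E. \<exists>m \<in> M. Cod C e = Dom C m \<and> f = Comp C m e) \<and>
     (\<forall>e \<in> E. \<forall>m \<in> M. orthogonal C e m) \<and>
     (\<forall>e \<in> E. is_epi C e) \<and> (\<forall>m \<in> M. is_mono C m)"


section \<open>Lattices\<close>

definition modular_lattice :: "'c gorder \<Rightarrow> bool" where
  "modular_lattice L \<longleftrightarrow> Lattice.lattice L \<and>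
     (\<forall>x \<in> carrier L. \<forall>y \<in> carrier L. \<forall>z \<in> carrier L.
        x \<sqsubseteq>\<^bsub>L\<^esub> z \<longrightarrow> x \<squnion>\<^bsub>L\<^esub> (y \<sqinter>\<^bsub>L\<^esub> z) = (x \<squnion>\<^bsub>L\<^esub> y) \<sqinter>\<^bsub>L\<^esub> z)"

definition compact_element :: "'c gorder \<Rightarrow> 'c \<Rightarrow> bool" where
  "compact_element L c \<longleftrightarrow> c \<in> carrier L \<and>
     (\<forall>A \<subseteq> carrier L. c \<sqsubseteq>\<^bsub>L\<^esub> \<Squnion>\<^bsub>L\<^esub> A \<longrightarrow>
        (\<exists>B \<subseteq> A. finite B \<and> c \<sqsubseteq>\<^bsub>L\<^esub> \<Squnion>\<^bsub>L\<^esub> B))"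

definition complete_algebraic_lattice :: "'c gorder \<Rightarrow> bool" where
  "complete_algebraic_lattice L \<longleftrightarrow> Complete_Lattice.complete_lattice L \<and>
     (\<forall>x \<in> carrier L. \<exists>A \<subseteq> {c. compact_element L c}. x = \<Squnion>\<^bsub>L\<^esub> A)"


section \<open>Forms\<close>

text \<open>\<open>Fib F X\<close> is the fibre over \<open>X\<close>, \<open>Dir F f\<close> is $f_!$ and \<open>Inv F f\<close> is $f^*$.
  Only their values on the fibres over the domain and the codomain of \<open>f\<close>, respectively,
  are relevant.\<close>

record ('o, 'm, 'c) form =
  Fib :: "'o \<Rightarrow> 'c gorder"
  Dir :: "'m \<Rightarrow> 'c \<Rightarrow> 'c"
  Inv :: "'m \<Rightarrow> 'c \<Rightarrow> 'c"

text \<open>The clusters of a form are drawn from the universe. As the fibres are sets of the universe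
  up to bijection, this is no restriction on the lattices that can occur.\<close>

locale orean_form = category C
  for C :: "('o, 'm) cat" +
  fixes elts :: "'u \<Rightarrow> 'u set" and F :: "('o, 'm, 'u) form"
  assumes Fib_small: "X \<in> Obj C \<Longrightarrow> small elts (carrier (Fib F X))"
    and Fib_lattice: "X \<in> Obj C \<Longrightarrow> Lattice.bounded_lattice (Fib F X)"
    and Dir_funcset: "f \<in> Hom C X Y \<Longrightarrow> Dir F f \<in> carrier (Fib F X) \<rightarrow> carrier (Fib F Y)"
    and Inv_funcset: "f \<in> Hom C X Y \<Longrightarrow> Inv F f \<in> carrier (Fib F Y) \<rightarrow> carrier (Fib F X)"
    and Dir_mono: "f \<in> Hom C X Y \<Longrightarrow> isotone (Fib F X) (Fib F Y) (Dir F f)"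
    and Inv_mono: "f \<in> Hom C X Y \<Longrightarrow> isotone (Fib F Y) (Fib F X) (Inv F f)"
    and adjunction: "f \<in> Hom C X Y \<Longrightarrow> S \<in> carrier (Fib F X) \<Longrightarrow> T \<in> carrier (Fib F Y) \<Longrightarrow>
      Dir F f S \<sqsubseteq>\<^bsub>Fib F Y\<^esub> T \<longleftrightarrow> S \<sqsubseteq>\<^bsub>Fib F X\<^esub> Inv F f T"
    and Dir_Comp: "f \<in> Hom C X Y \<Longrightarrow> g \<in> Hom C Y Z \<Longrightarrow> S \<in> carrier (Fib F X) \<Longrightarrow>
      Dir F (Comp C g f) S = Dir F g (Dir F f S)"
    and Inv_Comp: "f \<in> Hom C X Y \<Longrightarrow> g \<in> Hom C Y Z \<Longrightarrow> T \<in> carrier (Fib F Z) \<Longrightarrow>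
      Inv F (Comp C g f) T = Inv F f (Inv F g T)"
    and Dir_Id: "X \<in> Obj C \<Longrightarrow> S \<in> carrier (Fib F X) \<Longrightarrow> Dir F (Id C X) S = S"
    and Inv_Id: "X \<in> Obj C \<Longrightarrow> S \<in> carrier (Fib F X) \<Longrightarrow> Inv F (Id C X) S = S"

definition Im_cl :: "('o, 'm) cat \<Rightarrow> ('o, 'm, 'c) form \<Rightarrow> 'm \<Rightarrow> 'c" where
  "Im_cl C F f = Dir F f \<top>\<^bsub>Fib F (Dom C f)\<^esub>"

definition Ker_cl :: "('o, 'm) cat \<Rightarrow> ('o, 'm, 'c) form \<Rightarrow> 'm \<Rightarrow> 'c" where
  "Ker_cl C F f = Inv F f \<bottom>\<^bsub>Fib F (Cod C f)\<^esub>"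

definition conormal :: "('o, 'm) cat \<Rightarrow> ('o, 'm, 'c) form \<Rightarrow> 'o \<Rightarrow> 'c \<Rightarrow> bool" where
  "conormal C F X S \<longleftrightarrow> (\<exists>f \<in> Arr C. Cod C f = X \<and> Im_cl C F f = S)"

definition normal :: "('o, 'm) cat \<Rightarrow> ('o, 'm, 'c) form \<Rightarrow> 'o \<Rightarrow> 'c \<Rightarrow> bool" where
  "normal C F X K \<longleftrightarrow> (\<exists>f \<in> Arr C. Dom C f = X \<and> Ker_cl C F f = K)"

definition is_embedding ::
  "('o, 'm) cat \<Rightarrow> ('o, 'm, 'c) form \<Rightarrow> 'o \<Rightarrow> 'c \<Rightarrow> 'm \<Rightarrow> bool" where
  "is_embedding C F X S \<iota> \<longleftrightarrow>
     conormal C F X S \<and> \<iota> \<in> Arr C \<and> Cod C \<iota> = X \<and> Im_cl C F \<iota> = S \<and>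
     (\<forall>f \<in> Arr C. Cod C f = X \<and> Im_cl C F f \<sqsubseteq>\<^bsub>Fib F X\<^esub> S \<longrightarrow>
        (\<exists>!h. h \<in> Hom C (Dom C f) (Dom C \<iota>) \<and> f = Comp C \<iota> h))"

definition is_quotient ::
  "('o, 'm) cat \<Rightarrow> ('o, 'm, 'c) form \<Rightarrow> 'o \<Rightarrow> 'c \<Rightarrow> 'm \<Rightarrow> bool" where
  "is_quotient C F X K \<pi> \<longleftrightarrow>
     normal C F X K \<and> \<pi> \<in> Arr C \<and> Dom C \<pi> = X \<and> Ker_cl C F \<pi> = K \<and>
     (\<forall>g \<in> Arr C. Dom C g = X \<and> K \<sqsubseteq>\<^bsub>Fib F X\<^esub> Ker_cl C F g \<longrightarrow>
        (\<exists>!h. h \<in> Hom C (Cod C \<pi>) (Cod C g) \<and> g = Comp C h \<pi>))"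

locale noetherian_form = orean_form C elts F
  for C :: "('o, 'm) cat" and elts :: "'u \<Rightarrow> 'u set" and F :: "('o, 'm, 'u) form" +
  assumes N1_Inv_Dir: "f \<in> Hom C X Y \<Longrightarrow> S \<in> carrier (Fib F X) \<Longrightarrow>
      Inv F f (Dir F f S) = S \<squnion>\<^bsub>Fib F X\<^esub> Ker_cl C F f"
    and N1_Dir_Inv: "f \<in> Hom C X Y \<Longrightarrow> T \<in> carrier (Fib F Y) \<Longrightarrow>
      Dir F f (Inv F f T) = T \<sqinter>\<^bsub>Fib F Y\<^esub> Im_cl C F f"
    and N2: "f \<in> Hom C X Y \<Longrightarrow>
      \<exists>e m. is_quotient C F X (Ker_cl C F f) e \<and> is_embedding C F Y (Im_cl C F f) m \<and>
            Cod C e = Dom C m \<and> f = Comp C m e"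
    and N3_normal: "X \<in> Obj C \<Longrightarrow> normal C F X K \<Longrightarrow> normal C F X K' \<Longrightarrow>
      normal C F X (K \<squnion>\<^bsub>Fib F X\<^esub> K')"
    and N3_conormal: "X \<in> Obj C \<Longrightarrow> conormal C F X S \<Longrightarrow> conormal C F X S' \<Longrightarrow>
      conormal C F X (S \<sqinter>\<^bsub>Fib F X\<^esub> S')"

definition induces :: "('o, 'm) cat \<Rightarrow> ('o, 'm, 'c) form \<Rightarrow> 'm set \<Rightarrow> 'm set \<Rightarrow> bool" where
  "induces C F E M \<longleftrightarrow> proper_factorization_system C E M \<and>
     E = {\<pi>. \<exists>X K. is_quotient C F X K \<pi>} \<and>
     M = {\<iota>. \<exists>X S. is_embedding C F X S \<iota>}"


section \<open>The category of measurable spaces\<close>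

text \<open>An object is a pair of an underlying set and its measurable subsets. A morphism carries its
  domain and codomain; its underlying function is made extensional (undefined outside the
  underlying set of the domain), so that equal morphisms are equal as functions on that set.\<close>

type_synonym 'u mspace = "'u set \<times> 'u set set"
type_synonym 'u mmap = "'u mspace \<times> ('u \<Rightarrow> 'u) \<times> 'u mspace"

abbreviation pts :: "'u mspace \<Rightarrow> 'u set" where "pts X \<equiv> fst X"
abbreviation msets :: "'u mspace \<Rightarrow> 'u set set" where "msets X \<equiv> snd X"

abbreviation dom_sp :: "'u mmap \<Rightarrow> 'u mspace" where "dom_sp f \<equiv> fst f"
abbreviation fun_of :: "'u mmap \<Rightarrow> 'u \<Rightarrow> 'u" where "fun_of f \<equiv> fst (snd f)"
abbreviation cod_sp :: "'u mmap \<Rightarrow> 'u mspace" where "cod_sp f \<equiv> snd (snd f)"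

definition meas_spaces :: "('u \<Rightarrow> 'u set) \<Rightarrow> 'u mspace set" where
  "meas_spaces elts = {X. small elts (pts X) \<and> sigma_algebra (pts X) (msets X)}"

definition meas_maps :: "('u \<Rightarrow> 'u set) \<Rightarrow> 'u mmap set" where
  "meas_maps elts = {f. dom_sp f \<in> meas_spaces elts \<and> cod_sp f \<in> meas_spaces elts \<and>
     fun_of f \<in> pts (dom_sp f) \<rightarrow>\<^sub>E pts (cod_sp f) \<and>
     (\<forall>B \<in> msets (cod_sp f). fun_of f -` B \<inter> pts (dom_sp f) \<in> msets (dom_sp f))}"

definition Meas :: "('u \<Rightarrow> 'u set) \<Rightarrow> ('u mspace, 'u mmap) cat" where
  "Meas elts =
     \<lparr>Obj = meas_spaces elts,
      Arr = meas_maps elts,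
      Dom = dom_sp,
      Cod = cod_sp,
      Id = (\<lambda>X. (X, restrict (\<lambda>x. x) (pts X), X)),
      Comp = (\<lambda>g f. (dom_sp f, compose (pts (dom_sp f)) (fun_of g) (fun_of f), cod_sp g))\<rparr>"

definition surjective_meas_maps :: "('u \<Rightarrow> 'u set) \<Rightarrow> 'u mmap set" where
  "surjective_meas_maps elts =
     {f \<in> meas_maps elts. fun_of f ` pts (dom_sp f) = pts (cod_sp f)}"

definition injective_trace_meas_maps :: "('u \<Rightarrow> 'u set) \<Rightarrow> 'u mmap set" where
  "injective_trace_meas_maps elts =
     {f \<in> meas_maps elts. inj_on (fun_of f) (pts (dom_sp f)) \<and>
        msets (dom_sp f) = {fun_of f -` B \<inter> pts (dom_sp f) | B. B \<in> msets (cod_sp f)}}"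

lemma category_Meas: "category (Meas elts)"
proof -
  have id: "(X, restrict (\<lambda>x. x) (pts X), X) \<in> meas_maps elts"
    if X: "X \<in> meas_spaces elts" for X :: "'a mspace"
  proof -
    have "restrict (\<lambda>x. x) (pts X) -` B \<inter> pts X = B" if "B \<in> msets X" for B
    proof -
      have "B \<subseteq> pts X"
        using X that sigma_algebra.axioms(1) algebra.axioms(1) ring_of_sets.axioms(1)
          semiring_of_sets.axioms(1) subset_class.sets_into_space
        unfolding meas_spaces_def by blast
      then show ?thesis by auto
    qed
    with X show ?thesis by (auto simp: meas_maps_def)
  qed
  have comp: "(dom_sp f, compose (pts (dom_sp f)) (fun_of g) (fun_of f), cod_sp g) \<in> meas_maps elts"
    if f: "f \<in> meas_maps elts" and g: "g \<in> meas_maps elts" and fg: "cod_sp f = dom_sp g"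
    for f g :: "'a mmap"
  proof -
    have maps: "fun_of f x \<in> pts (dom_sp g)" if "x \<in> pts (dom_sp f)" for x
      using f fg that by (auto simp: meas_maps_def)
    have "compose (pts (dom_sp f)) (fun_of g) (fun_of f) -` B \<inter> pts (dom_sp f) =
        fun_of f -` (fun_of g -` B \<inter> pts (dom_sp g)) \<inter> pts (dom_sp f)" for B
      using maps by (auto simp: compose_def)
    moreover have "fun_of f -` (fun_of g -` B \<inter> pts (dom_sp g)) \<inter> pts (dom_sp f) \<in> msets (dom_sp f)"
      if "B \<in> msets (cod_sp g)" for B
      using f g fg that unfolding meas_maps_def by fastforce
    ultimately have "compose (pts (dom_sp f)) (fun_of g) (fun_of f) -` B \<inter> pts (dom_sp f)
        \<in> msets (dom_sp f)" if "B \<in> msets (cod_sp g)" for B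
      using that by metis
    moreover have "compose (pts (dom_sp f)) (fun_of g) (fun_of f) \<in> pts (dom_sp f) \<rightarrow>\<^sub>E pts (cod_sp g)"
      using g maps by (auto simp: meas_maps_def compose_def)
    ultimately show ?thesis
      using f g unfolding meas_maps_def by simp
  qed
  have ext: "restrict (fun_of f) (pts (dom_sp f)) = fun_of f"
    if "f \<in> meas_maps elts" for f :: "'a mmap"
    using that by (auto simp: meas_maps_def PiE_def extensional_restrict)
  have maps: "fun_of f x \<in> pts (cod_sp f)"
    if "f \<in> meas_maps elts" "x \<in> pts (dom_sp f)" for f :: "'a mmap" and x
    using that by (auto simp: meas_maps_def)
  show ?thesis
  proof
    fix f assume "f \<in> Arr (Meas elts)"
    then show "Dom (Meas elts) f \<in> Obj (Meas elts)" "Cod (Meas elts) f \<in> Obj (Meas elts)"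
      by (auto simp: Meas_def meas_maps_def)
  next
    fix X assume "X \<in> Obj (Meas elts)"
    then show "Id (Meas elts) X \<in> Hom (Meas elts) X X"
      using id by (auto simp: Meas_def Hom_def)
  next
    fix f g X Y Z assume "f \<in> Hom (Meas elts) X Y" "g \<in> Hom (Meas elts) Y Z"
    then show "Comp (Meas elts) g f \<in> Hom (Meas elts) X Z"
      using comp[of f g] by (auto simp: Meas_def Hom_def)
  next
    fix f X Y assume f: "f \<in> Hom (Meas elts) X Y"
    have "compose (pts X) (fun_of f) (restrict (\<lambda>x. x) (pts X)) = fun_of f"
      using ext[of f] f by (simp add: Meas_def Hom_def compose_def restrict_def fun_eq_iff) metis
    then show "Comp (Meas elts) f (Id (Meas elts) X) = f"
      using f by (auto simp: Meas_def Hom_def prod_eq_iff)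
    have "compose (pts X) (restrict (\<lambda>x. x) (pts Y)) (fun_of f) = restrict (fun_of f) (pts X)"
      using maps[of f] f by (auto simp: Meas_def Hom_def compose_def restrict_def fun_eq_iff)
    then show "Comp (Meas elts) (Id (Meas elts) Y) f = f"
      using f ext[of f] by (auto simp: Meas_def Hom_def prod_eq_iff)
  next
    fix f g h W X Y Z
    assume f: "f \<in> Hom (Meas elts) W X" and "g \<in> Hom (Meas elts) X Y" "h \<in> Hom (Meas elts) Y Z"
    then show "Comp (Meas elts) h (Comp (Meas elts) g f) = Comp (Meas elts) (Comp (Meas elts) h g) f"
      using maps[of f] by (auto simp: Meas_def Hom_def compose_def restrict_def fun_eq_iff)
  qed
qed

end

theory Submission
  imports Defs
begin

text \<open>Attach to each measurable space \<open>X\<close> a set \<open>H(X)\<close>, contravariantly, so that surjections induce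
  injections, embeddings induce surjections, two elements of \<open>H(X)\<close> agreeing on \<open>A \<inter> B\<close> can be
  interpolated by one agreeing with the first on \<open>A\<close> and with the second on \<open>B\<close>, and, inside
  \<open>H(X)\<close>, the images of two quotients of \<open>X\<close> intersect in the image of a third one. Measurable sets
  have all these properties except interpolation, which fails because \<open>A\<close> and \<open>B\<close> need not be
  measurable; so interpolants are adjoined freely, which preserves the other properties.

  The fibre over \<open>X\<close> consists of the linear subspaces of the \<open>F\<^sub>2\<close>-vector space of all subsets of
  \<open>H(X)\<close>. A map \<open>f : X \<rightarrow> Y\<close> induces \<open>H(Y) \<rightarrow> H(X)\<close>, hence a linear map from the subsets of \<open>H(X)\<close>
  to those of \<open>H(Y)\<close>, and the form is given by direct and inverse images of subspaces. The kernel of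
  \<open>f\<close> is the space of subsets of \<open>H(X)\<close> disjoint from the image of \<open>H(Y)\<close>, and the image of \<open>f\<close> is
  the space of subsets of \<open>H(Y)\<close> saturated for \<open>H(Y) \<rightarrow> H(X)\<close>. Thus joins of kernels are controlled by
  intersections of quotients and meets of images by interpolation.\<close>

section \<open>Free interpolants\<close>

text \<open>\<open>Glue A s B t\<close> is a formal interpolant, equal to \<open>s\<close> on \<open>A\<close> and to \<open>t\<close> on \<open>B\<close>. No relation is
  imposed on its values elsewhere, which is why \<open>A\<close> and \<open>B\<close> are required to be proper subsets.\<close>

datatype 'a cterm = Base "'a set" | Glue "'a set" "'a cterm" "'a set" "'a cterm"

text \<open>A gluing collapses to the prescribed side as soon as the image of \<open>f\<close> lies
  in one of its two sets, so that it really takes these values there. If the image lies in both sets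
  the first side is taken; the agreement clause of \<open>valid\<close> makes this choice
  harmless.\<close>

primrec pullback :: "'a set \<Rightarrow> ('a \<Rightarrow> 'a) \<Rightarrow> 'a cterm \<Rightarrow> 'a cterm" where
  "pullback Z f (Base S) = Base (f -` S \<inter> Z)"
| "pullback Z f (Glue A s B t) =
    (if f ` Z \<subseteq> A then pullback Z f s
     else if f ` Z \<subseteq> B then pullback Z f t
     else Glue (f -` A \<inter> Z) (pullback Z f s) (f -` B \<inter> Z) (pullback Z f t))"

abbreviation restr :: "'a set \<Rightarrow> 'a cterm \<Rightarrow> 'a cterm" where
  "restr A \<equiv> pullback A (\<lambda>x. x)"

text \<open>Properness of \<open>A\<close> and \<open>B\<close> keeps gluings in normal form: none
  of them collapses when restricted to \<open>X\<close> itself. Agreement over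
  \<open>A \<inter> B\<close> is what makes \<open>pullback\<close> functorial.\<close>

primrec valid :: "'a set \<Rightarrow> 'a set set \<Rightarrow> 'a cterm \<Rightarrow> bool" where
  "valid X M (Base S) \<longleftrightarrow> S \<in> M"
| "valid X M (Glue A s B t) \<longleftrightarrow> A \<subset> X \<and> B \<subset> X \<and> valid X M s \<and> valid X M t \<and>
     restr (A \<inter> B) s = restr (A \<inter> B) t"

section \<open>Functoriality and validity of pullbacks of terms\<close>

lemma pullback_cong:
  assumes "\<And>x. x \<in> Z \<Longrightarrow> f x = g x"
  shows "pullback Z f t = pullback Z g t"
proof -
  have "f -` A \<inter> Z = g -` A \<inter> Z" "f ` Z = g ` Z" for A
    using assms by auto
  then show ?thesis by (induction t) auto
qed

text \<open>The delicate case is a \<open>g\<close> that lands in \<open>B\<close> but not in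
  \<open>A\<close> while the composite also lands in \<open>A\<close>: the inner pullback has chosen
  \<open>t\<close>, whereas the direct one chooses \<open>s\<close>. Agreement over
  \<open>A \<inter> B\<close> reconciles the two.\<close>

lemma pullback_pullback:
  assumes "valid Y M t" "f ` Z \<subseteq> X" "g ` X \<subseteq> Y"
  shows "pullback Z f (pullback X g t) = pullback Z (g \<circ> f) t"
  using assms
proof (induction t arbitrary: X Z f g)
  case (Base S)
  then show ?case by auto
next
  case (Glue A s B t)
  have IH: "pullback Z f (pullback X g s) = pullback Z (g \<circ> f) s"
    "pullback Z f (pullback X g t) = pullback Z (g \<circ> f) t"
    using Glue.IH(1)[OF _ Glue.prems(2,3)] Glue.IH(2)[OF _ Glue.prems(2,3)] Glue.prems(1)
    by (simp_all add: comp_def)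
  \<comment> \<open>A map into \<open>A \<inter> B\<close> factors through the inclusion of that set
    into \<open>Y\<close>. The induction hypotheses are applied to this factorization, which is why
    spaces and maps are arbitrary in the induction.\<close>
  have agree: "pullback Z h s = pullback Z h t" if "h ` Z \<subseteq> A \<inter> B" for h
  proof -
    have AB: "(\<lambda>x. x) ` (A \<inter> B) \<subseteq> Y" "valid Y M s" "valid Y M t"
        "restr (A \<inter> B) s = restr (A \<inter> B) t"
      using Glue.prems(1) by auto
    have "pullback Z h (restr (A \<inter> B) s) = pullback Z ((\<lambda>x. x) \<circ> h) s"
      using Glue.IH(1)[OF AB(2) that AB(1)] .
    moreover have "pullback Z h (restr (A \<inter> B) t) = pullback Z ((\<lambda>x. x) \<circ> h) t"
      using Glue.IH(2)[OF AB(3) that AB(1)] .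
    ultimately show ?thesis using AB(4) by (simp add: comp_def)
  qed
  have img: "f ` Z \<subseteq> g -` C \<inter> X \<longleftrightarrow> (g \<circ> f) ` Z \<subseteq> C" for C
    using Glue.prems(2) by auto
  have vim: "f -` (g -` C \<inter> X) \<inter> Z = (g \<circ> f) -` C \<inter> Z" for C
    using Glue.prems(2) by auto
  have sub: "g ` X \<subseteq> C \<Longrightarrow> (g \<circ> f) ` Z \<subseteq> C" for C
    using Glue.prems(2) by auto
  show ?case
  proof (cases "g ` X \<subseteq> A")
    case True
    with sub[of A] IH show ?thesis by (simp add: comp_def)
  next
    case nA: False
    show ?thesis
    proof (cases "g ` X \<subseteq> B")
      case True
      with sub[of B] IH agree[of "g \<circ> f"] nA show ?thesis by (auto simp: comp_def)
    next
      case False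
      with nA IH img vim show ?thesis by (simp add: comp_def)
    qed
  qed
qed

lemma restr_self:
  assumes "M \<subseteq> Pow X" "valid X M t"
  shows "restr X t = t"
  using assms by (induction t) (auto simp: vimage_def Int_absorb1)

text \<open>The preimages of \<open>A\<close> and \<open>B\<close> are again proper because the
  \<open>Glue\<close> branch is reached only when the image of \<open>f\<close> lies in neither set.
  Agreement survives because \<open>f\<close> maps the intersection of the preimages into
  \<open>A \<inter> B\<close>.\<close>

lemma valid_pullback:
  assumes "valid Y N t" "f ` X \<subseteq> Y" "\<And>B. B \<in> N \<Longrightarrow> f -` B \<inter> X \<in> M"
  shows "valid X M (pullback X f t)"
  using assms(1)
proof (induction t)
  case (Base S)
  then show ?case using assms(3) by simp
next
  case (Glue A s B t)
  let ?D = "(f -` A \<inter> X) \<inter> (f -` B \<inter> X)"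
  have D: "f ` ?D \<subseteq> A \<inter> B" "A \<inter> B \<subseteq> Y" using Glue.prems by auto
  have *: "restr ?D (pullback X f u) = pullback ?D f (restr (A \<inter> B) u)" if "valid Y N u" for u
    using that assms(2) D pullback_pullback[of Y N u "\<lambda>x. x" ?D X f]
      pullback_pullback[of Y N u f ?D "A \<inter> B" "\<lambda>x. x"] by (auto simp: comp_def)
  have "restr ?D (pullback X f s) = restr ?D (pullback X f t)"
    using Glue.prems *[of s] *[of t] by simp
  then show ?case using Glue by auto
qed

section \<open>Pullback along surjections and along embeddings\<close>

lemma pullback_inj_iff:
  assumes "valid Y N s" "valid Y N t" "f ` X = Y" "N \<subseteq> Pow Y"
  shows "pullback X f s = pullback X f t \<longleftrightarrow> s = t"
proof -
  have vim: "f -` A \<inter> X = f -` B \<inter> X \<longleftrightarrow> A = B" if "A \<subseteq> Y" "B \<subseteq> Y" for A B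
    using that assms(3) by blast
  have "pullback X f s = pullback X f t \<Longrightarrow> s = t"
    using assms(1,2)
  proof (induction s arbitrary: t)
    case (Base S)
    \<comment> \<open>As \<open>f\<close> is onto and the sets of a valid gluing are proper, no
      gluing collapses, so the pullback has the same outermost constructor as the term.\<close>
    from Base.prems(1) obtain T where T: "t = Base T" "f -` S \<inter> X = f -` T \<inter> X"
      using Base.prems(3) assms(3) by (cases t) (auto split: if_splits simp: psubset_eq)
    moreover have "S \<subseteq> Y" "T \<subseteq> Y" using Base.prems T(1) assms(4) by auto
    ultimately show ?case using vim by simp
  next
    case (Glue A u B v)
    then show ?case using assms(3,4) vim
      by (cases t) (auto split: if_splits simp: psubset_eq)
  qed
  then show ?thesis by blast
qed

text \<open>Since nothing collapses along a surjection, the shape of a term can be read off from its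
  pullback; the same holds for \<open>pullback_eq_Glue\<close>.\<close>

lemma pullback_eq_Base:
  assumes "valid Y N t" "f ` X = Y" "pullback X f t = Base S"
  obtains S' where "t = Base S'" "S' \<in> N" "S = f -` S' \<inter> X"
  using assms by (cases t) (auto split: if_splits simp: psubset_eq)

lemma pullback_eq_Glue:
  assumes "valid Y N t" "f ` X = Y" "pullback X f t = Glue A u B v"
  obtains A' u' B' v' where "t = Glue A' u' B' v'" "A = f -` A' \<inter> X" "B = f -` B' \<inter> X"
    "u = pullback X f u'" "v = pullback X f v'"
  using assms by (cases t) (auto split: if_splits simp: psubset_eq)

text \<open>Base sets extend by the trace hypothesis. A gluing extends by taking the images of its
  two sets, which may be arbitrary proper subsets and so need not become measurable. Injectivity
  keeps the images proper and prevents the new gluing from collapsing over \<open>X\<close>.\<close>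

lemma pullback_surj:
  assumes "valid X M t" "inj_on f X" "f ` X \<subseteq> Y" "M = {f -` B \<inter> X | B. B \<in> N}"
  obtains t' where "valid Y N t'" "pullback X f t' = t"
proof -
  have "\<exists>t'. valid Y N t' \<and> pullback X f t' = t"
    using assms(1)
  proof (induction t)
    case (Base S)
    then obtain B where "B \<in> N" "S = f -` B \<inter> X" using assms(4) by auto
    then show ?case by (intro exI[of _ "Base B"]) auto
  next
    case (Glue A s B t)
    then obtain s' t' where st: "valid Y N s'" "pullback X f s' = s" "valid Y N t'" "pullback X f t' = t"
      by auto
    have AB: "A \<subset> X" "B \<subset> X" "restr (A \<inter> B) s = restr (A \<inter> B) t" using Glue.prems by auto
    have vim: "f -` f ` C \<inter> X = C" "f ` X \<subseteq> f ` C \<longleftrightarrow> C = X" if "C \<subseteq> X" for C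
      using that assms(2) inj_on_image_eq_iff[OF assms(2) that subset_refl]
      by (auto dest: inj_onD)
    have pr: "f ` C \<subset> Y" if "C \<subset> X" for C
      using that vim(2)[of C] assms(3) by blast
    \<comment> \<open>By injectivity \<open>?D\<close> is the image of \<open>A \<inter> B\<close>,
      and \<open>?g\<close> inverts \<open>f\<close> there; pulling back along \<open>?g\<close>
      transports the agreement of \<open>s\<close> and \<open>t\<close> to
      \<open>?D\<close>.\<close>
    let ?D = "f ` A \<inter> f ` B" and ?g = "inv_into X f"
    have D: "?D = f ` (A \<inter> B)"
      using AB(1,2) by (intro inj_on_image_Int[OF assms(2), symmetric]) auto
    have g: "?g ` ?D \<subseteq> A \<inter> B"
      using AB(1,2) assms(2) unfolding D by (auto simp: subset_iff)
    have *: "restr ?D w = pullback ?D ?g (restr (A \<inter> B) (pullback X f w))" if w: "valid Y N w" for w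
    proof -
      have "restr (A \<inter> B) (pullback X f w) = pullback (A \<inter> B) f w"
        using w AB assms(3) pullback_pullback[of Y N w "\<lambda>x. x" "A \<inter> B" X f] by (auto simp: comp_def)
      moreover have "pullback ?D ?g (pullback (A \<inter> B) f w) = pullback ?D (f \<circ> ?g) w"
        using w g AB assms(3) by (intro pullback_pullback) auto
      moreover have "\<dots> = restr ?D w"
        using AB by (intro pullback_cong) (auto simp: f_inv_into_f)
      ultimately show ?thesis by simp
    qed
    have "restr ?D s' = restr ?D t'"
      using *[of s'] *[of t'] st AB(3) by simp
    then show ?case
      using st AB vim pr by (intro exI[of _ "Glue (f ` A) s' (f ` B) t'"]) (auto simp: psubset_eq)
  qed
  then show ?thesis using that by blast
qed

text \<open>This is the interpolation property for the sake of which gluings were adjoined. When one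
  of the sets is all of \<open>X\<close>, a gluing would be invalid, but then \<open>s\<close> or
  \<open>t\<close> itself interpolates.\<close>

lemma glue:
  assumes "valid X M s" "valid X M t" "A \<subseteq> X" "B \<subseteq> X" "restr (A \<inter> B) s = restr (A \<inter> B) t"
  obtains w where "valid X M w" "restr A w = restr A s" "restr B w = restr B t"
proof -
  consider "A = X" | "B = X" | "A \<subset> X" "B \<subset> X" using assms by blast
  then show ?thesis
  proof cases
    case 1
    then show ?thesis using assms that[of s] by (simp add: Int_absorb1)
  next
    case 2
    then show ?thesis using assms that[of t] by (simp add: Int_absorb2)
  next
    case 3
    \<comment> \<open>If \<open>B \<subseteq> A\<close>, restricting the gluing to \<open>B\<close>
      takes the first branch and yields a restriction of \<open>s\<close> instead of
      \<open>t\<close>.\<close>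
    have "restr B s = restr B t" if "B \<subseteq> A"
      using that assms(5) by (simp add: Int_absorb1)
    with 3 show ?thesis
      using assms by (intro that[of "Glue A s B t"]) auto
  qed
qed

text \<open>Every set occurring in \<open>t\<close> is a preimage along \<open>f\<close> and along
  \<open>g\<close>, hence saturated for both, hence by \<open>sat\<close> saturated for
  \<open>r\<close>. So it is the preimage of its image under \<open>r\<close>, and the term can be
  rebuilt over \<open>Y\<close> from these images.\<close>

lemma pullback_common:
  assumes t: "valid X M t" and r: "r ` X = Y"
    and f: "f ` X = Y1" "valid Y1 N1 t1" "pullback X f t1 = t"
    and g: "g ` X = Y2" "valid Y2 N2 t2" "pullback X g t2 = t"
    and sat: "\<And>A. A \<subseteq> X \<Longrightarrow> f -` f ` A \<inter> X = A \<Longrightarrow> g -` g ` A \<inter> X = A \<Longrightarrow> r -` r ` A \<inter> X = A"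
    and N: "N = {S. S \<subseteq> Y \<and> (\<exists>S1 \<in> N1. r -` S \<inter> X = f -` S1 \<inter> X) \<and>
                    (\<exists>S2 \<in> N2. r -` S \<inter> X = g -` S2 \<inter> X)}"
  obtains t' where "valid Y N t'" "pullback X r t' = t"
proof -
  have sat': "r -` r ` A \<inter> X = A" if "A = f -` A1 \<inter> X" "A = g -` A2 \<inter> X" for A A1 A2
  proof (rule sat)
    show "A \<subseteq> X" "f -` f ` A \<inter> X = A" using that(1) by auto
    show "g -` g ` A \<inter> X = A" using that(2) by auto
  qed
  have "\<exists>t'. valid Y N t' \<and> pullback X r t' = t"
    using t f(2,3) g(2,3)
  proof (induction t arbitrary: t1 t2)
    case (Base S)
    obtain S1 where S1: "S1 \<in> N1" "S = f -` S1 \<inter> X"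
      using pullback_eq_Base[OF Base.prems(2) f(1) Base.prems(3)] by metis
    obtain S2 where S2: "S2 \<in> N2" "S = g -` S2 \<inter> X"
      using pullback_eq_Base[OF Base.prems(4) g(1) Base.prems(5)] by metis
    have S: "r -` r ` S \<inter> X = S" using sat'[OF S1(2) S2(2)] .
    moreover have "r ` S \<subseteq> Y" using S r by auto
    moreover have "\<exists>T\<in>N1. S = f -` T \<inter> X" "\<exists>T\<in>N2. S = g -` T \<inter> X" using S1 S2 by blast+
    ultimately have "r ` S \<in> N" unfolding N by simp
    then show ?case using S by (intro exI[of _ "Base (r ` S)"]) auto
  next
    case (Glue A u B v)
    obtain A1 u1 B1 v1 where 1: "t1 = Glue A1 u1 B1 v1" "A = f -` A1 \<inter> X" "B = f -` B1 \<inter> X"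
        "u = pullback X f u1" "v = pullback X f v1"
      using pullback_eq_Glue[OF Glue.prems(2) f(1) Glue.prems(3)] by metis
    obtain A2 u2 B2 v2 where 2: "t2 = Glue A2 u2 B2 v2" "A = g -` A2 \<inter> X" "B = g -` B2 \<inter> X"
        "u = pullback X g u2" "v = pullback X g v2"
      using pullback_eq_Glue[OF Glue.prems(4) g(1) Glue.prems(5)] by metis
    have uv: "valid X M u" "valid X M v" "valid Y1 N1 u1" "valid Y1 N1 v1" "valid Y2 N2 u2" "valid Y2 N2 v2"
      using Glue.prems(1,2,4) unfolding 1(1) 2(1) by simp_all
    obtain u' where u': "valid Y N u'" "pullback X r u' = u"
      using Glue.IH(1)[OF uv(1,3) 1(4)[symmetric] uv(5) 2(4)[symmetric]] by metis
    obtain v' where v': "valid Y N v'" "pullback X r v' = v"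
      using Glue.IH(2)[OF uv(2,4) 1(5)[symmetric] uv(6) 2(5)[symmetric]] by metis
    have A: "r -` r ` A \<inter> X = A" and B: "r -` r ` B \<inter> X = B"
      using sat'[OF 1(2) 2(2)] sat'[OF 1(3) 2(3)] by simp_all
    have AB: "A \<subset> X" "B \<subset> X" "restr (A \<inter> B) u = restr (A \<inter> B) v" using Glue.prems(1) by auto
    have D: "r ` (A \<inter> B) = r ` A \<inter> r ` B" and DY: "r ` A \<inter> r ` B \<subseteq> Y"
      using A B AB r by blast+
    \<comment> \<open>Agreement must descend from \<open>A \<inter> B\<close> to \<open>?D\<close>.
      It does so because \<open>r\<close> maps \<open>A \<inter> B\<close> onto \<open>?D\<close>
      and pullback along a surjection is injective; \<open>?N\<close> is the trace of
      \<open>N\<close> on \<open>?D\<close>, over which the restricted terms are valid.\<close>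
    let ?D = "r ` A \<inter> r ` B" and ?N = "(\<lambda>S. S \<inter> (r ` A \<inter> r ` B)) ` N"
    have *: "restr (A \<inter> B) (pullback X r w) = pullback (A \<inter> B) r (restr ?D w)" if "valid Y N w" for w
      using that AB r D DY pullback_pullback[of Y N w "\<lambda>x. x" "A \<inter> B" X r]
        pullback_pullback[of Y N w r "A \<inter> B" ?D "\<lambda>x. x"] by (auto simp: comp_def)
    have val: "valid ?D ?N (restr ?D w)" if "valid Y N w" for w
      using that DY by (intro valid_pullback[of Y N]) auto
    have "pullback (A \<inter> B) r (restr ?D u') = pullback (A \<inter> B) r (restr ?D v')"
      using *[of u'] *[of v'] AB(3) u' v' by simp
    then have "restr ?D u' = restr ?D v'"
      using pullback_inj_iff[OF val[OF u'(1)] val[OF v'(1)] D] by auto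
    moreover have "r ` A \<subset> Y" "r ` B \<subset> Y" using A B AB r by blast+
    ultimately show ?case
      using A B u' v' r AB by (intro exI[of _ "Glue (r ` A) u' (r ` B) v'"]) (auto simp: psubset_eq)
  qed
  then show ?thesis using that by blast
qed

section \<open>Lattices of subspaces\<close>

text \<open>The symmetric difference is the addition of the vector space of subsets over the field with two
  elements.\<close>

definition subspaces :: "'t set \<Rightarrow> 't set set set" where
  "subspaces G = {S. S \<subseteq> Pow G \<and> {} \<in> S \<and> (\<forall>P \<in> S. \<forall>Q \<in> S. sym_diff P Q \<in> S)}"

definition sum_space :: "'t set set \<Rightarrow> 't set set \<Rightarrow> 't set set" where
  "sum_space S T = {sym_diff P Q | P Q. P \<in> S \<and> Q \<in> T}"

definition span_in :: "'t set \<Rightarrow> 't set set \<Rightarrow> 't set set" where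
  "span_in G V = \<Inter> {T \<in> subspaces G. V \<subseteq> T}"

lemma subspacesD:
  assumes "S \<in> subspaces G"
  shows "S \<subseteq> Pow G" "{} \<in> S" "P \<in> S \<Longrightarrow> Q \<in> S \<Longrightarrow> sym_diff P Q \<in> S"
  using assms by (auto simp: subspaces_def)

lemma Pow_subspace: "A \<subseteq> G \<Longrightarrow> Pow A \<in> subspaces G"
  by (auto simp: subspaces_def)

lemma empty_subspace: "{{}} \<in> subspaces G"
  by (auto simp: subspaces_def)

lemma Inter_subspace:
  assumes "\<S> \<noteq> {}" "\<S> \<subseteq> subspaces G"
  shows "\<Inter> \<S> \<in> subspaces G"
proof -
  have "\<Inter> \<S> \<subseteq> Pow G" using assms subspacesD(1)[of _ G] by blast
  moreover have "{} \<in> \<Inter> \<S>" using assms subspacesD(2)[of _ G] by blast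
  moreover have "sym_diff P Q \<in> \<Inter> \<S>" if "P \<in> \<Inter> \<S>" "Q \<in> \<Inter> \<S>" for P Q
    using that assms subspacesD(3)[of _ G P Q] by blast
  ultimately show ?thesis unfolding subspaces_def by simp
qed

lemma Int_subspace: "S \<in> subspaces G \<Longrightarrow> T \<in> subspaces G \<Longrightarrow> S \<inter> T \<in> subspaces G"
  by (auto simp: subspaces_def)

lemma span_in_subspace: "V \<subseteq> Pow G \<Longrightarrow> span_in G V \<in> subspaces G"
  unfolding span_in_def by (rule Inter_subspace) (use Pow_subspace[of G G] in auto)

lemma span_in_superset: "V \<subseteq> span_in G V"
  by (auto simp: span_in_def)

lemma span_in_least: "T \<in> subspaces G \<Longrightarrow> V \<subseteq> T \<Longrightarrow> span_in G V \<subseteq> T"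
  by (auto simp: span_in_def)

lemma sum_spaceI: "P \<in> S \<Longrightarrow> Q \<in> T \<Longrightarrow> sym_diff P Q \<in> sum_space S T"
  unfolding sum_space_def by (intro CollectI exI conjI) (rule refl)

lemma sum_spaceE:
  assumes "A \<in> sum_space S T"
  obtains P Q where "A = sym_diff P Q" "P \<in> S" "Q \<in> T"
  using assms unfolding sum_space_def mem_Collect_eq by metis

lemma sum_space_subspace:
  assumes "S \<in> subspaces G" "T \<in> subspaces G"
  shows "sum_space S T \<in> subspaces G"
proof -
  have "sym_diff A B \<in> sum_space S T" if A: "A \<in> sum_space S T" and B: "B \<in> sum_space S T" for A B
  proof -
    obtain P Q where PQ: "A = sym_diff P Q" "P \<in> S" "Q \<in> T" using A by (rule sum_spaceE)
    obtain P' Q' where PQ': "B = sym_diff P' Q'" "P' \<in> S" "Q' \<in> T" using B by (rule sum_spaceE)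
    have "sym_diff A B = sym_diff (sym_diff P P') (sym_diff Q Q')"
      unfolding PQ(1) PQ'(1) by auto
    moreover have "sym_diff P P' \<in> S" "sym_diff Q Q' \<in> T"
      using PQ PQ' subspacesD(3)[OF assms(1)] subspacesD(3)[OF assms(2)] by simp_all
    ultimately show ?thesis using sum_spaceI by metis
  qed
  moreover have "{} \<in> sum_space S T"
    using subspacesD(2)[OF assms(1)] subspacesD(2)[OF assms(2)] by (force simp: sum_space_def)
  moreover have "sum_space S T \<subseteq> Pow G"
    using subspacesD(1)[OF assms(1)] subspacesD(1)[OF assms(2)] by (auto simp: sum_space_def)
  ultimately show ?thesis by (simp add: subspaces_def)
qed

lemma sum_space_upper:
  assumes "S \<in> subspaces G" "T \<in> subspaces G"
  shows "S \<subseteq> sum_space S T" "T \<subseteq> sum_space S T"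
  using sum_spaceI[of _ S "{}" T] sum_spaceI[of "{}" S _ T]
    subspacesD(2)[OF assms(1)] subspacesD(2)[OF assms(2)] by auto

lemma sum_space_least:
  "U \<in> subspaces G \<Longrightarrow> S \<subseteq> U \<Longrightarrow> T \<subseteq> U \<Longrightarrow> sum_space S T \<subseteq> U"
  using subspacesD(3)[of U G] by (blast elim: sum_spaceE)

text \<open>On disjoint sets the symmetric difference is the union, so it suffices to split a set
  into its part in \<open>A\<close> and the rest. Kernels of maps are of the form
  \<open>Pow A\<close>, so this computes their joins.\<close>

lemma sum_space_Pow: "sum_space (Pow A) (Pow B) = Pow (A \<union> B)"
proof
  show "sum_space (Pow A) (Pow B) \<subseteq> Pow (A \<union> B)" by (auto elim: sum_spaceE)
  show "Pow (A \<union> B) \<subseteq> sum_space (Pow A) (Pow B)"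
  proof
    fix P assume "P \<in> Pow (A \<union> B)"
    then have "P = sym_diff (P \<inter> A) (P - A)" "P - A \<in> Pow B" by auto
    then show "P \<in> sum_space (Pow A) (Pow B)"
      using sum_spaceI[of "P \<inter> A" "Pow A" "P - A" "Pow B"] by simp
  qed
qed

text \<open>The argument for subspaces of any vector space: the summand \<open>Q\<close> from
  \<open>T\<close> is the difference of two vectors of \<open>U\<close>, and in characteristic two
  this difference is again \<open>sym_diff\<close>.\<close>

lemma sum_space_modular:
  assumes "S \<in> subspaces G" "U \<in> subspaces G" "S \<subseteq> U"
  shows "sum_space S (T \<inter> U) = sum_space S T \<inter> U"
proof
  show "sum_space S (T \<inter> U) \<subseteq> sum_space S T \<inter> U"
    using assms(3) subspacesD(3)[OF assms(2)] by (blast elim: sum_spaceE intro: sum_spaceI)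
  show "sum_space S T \<inter> U \<subseteq> sum_space S (T \<inter> U)"
  proof
    fix A assume A: "A \<in> sum_space S T \<inter> U"
    then obtain P Q where PQ: "A = sym_diff P Q" "P \<in> S" "Q \<in> T" by (blast elim: sum_spaceE)
    have "sym_diff P A = Q" unfolding PQ(1) by auto
    then have "Q \<in> U" using subspacesD(3)[OF assms(2), of P A] PQ assms(3) A by auto
    then show "A \<in> sum_space S (T \<inter> U)" unfolding PQ(1) using PQ by (intro sum_spaceI) auto
  qed
qed

text \<open>Clusters have to be elements of the universe, so a subspace is represented by its code
  under \<open>c\<close>, and codes are compared by decoding them.\<close>

definition fibre :: "'t set \<Rightarrow> ('t set set \<Rightarrow> 'c) \<Rightarrow> 'c gorder" where
  "fibre G c = \<lparr>carrier = c ` subspaces G, eq = (=),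
     le = (\<lambda>a b. inv_into (subspaces G) c a \<subseteq> inv_into (subspaces G) c b)\<rparr>"

text \<open>Joins, meets, top and bottom are defined by choice; uniqueness of least and greatest
  elements in a partial order allows them to be computed.\<close>

lemma (in partial_order) some_least: "least L s A \<Longrightarrow> (SOME x. least L x A) = s"
  by (rule least_unique[OF someI[of "\<lambda>x. least L x A"]])

lemma (in partial_order) some_greatest: "greatest L s A \<Longrightarrow> (SOME x. greatest L x A) = s"
  by (rule greatest_unique[OF someI[of "\<lambda>x. greatest L x A"]])

context
  fixes G :: "'t set" and c :: "'t set set \<Rightarrow> 'c"
  assumes inj: "inj_on c (subspaces G)"
begin

lemma carrier_fibre: "carrier (fibre G c) = c ` subspaces G"
  by (simp add: fibre_def)

lemma le_fibre:
  "S \<in> subspaces G \<Longrightarrow> T \<in> subspaces G \<Longrightarrow> c S \<sqsubseteq>\<^bsub>fibre G c\<^esub> c T \<longleftrightarrow> S \<subseteq> T"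
  using inj by (simp add: fibre_def inv_into_f_f)

lemma partial_order_fibre: "partial_order (fibre G c)"
proof
  fix x y assume "x \<in> carrier (fibre G c)" "y \<in> carrier (fibre G c)"
    "x \<sqsubseteq>\<^bsub>fibre G c\<^esub> y" "y \<sqsubseteq>\<^bsub>fibre G c\<^esub> x"
  then show "x .=\<^bsub>fibre G c\<^esub> y"
    unfolding carrier_fibre by (auto simp: le_fibre fibre_def inv_into_f_f[OF inj])
qed (auto simp: fibre_def)

lemma least_fibre:
  assumes S: "S \<in> subspaces G" and fam: "\<S> \<subseteq> subspaces G"
    and bound: "\<And>T. T \<in> \<S> \<Longrightarrow> T \<subseteq> S"
    and extremal: "\<And>U. U \<in> subspaces G \<Longrightarrow> (\<And>T. T \<in> \<S> \<Longrightarrow> T \<subseteq> U) \<Longrightarrow> S \<subseteq> U"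
  shows "least (fibre G c) (c S) (Upper (fibre G c) (c ` \<S>))"
proof (rule least_UpperI)
  show car: "c ` \<S> \<subseteq> carrier (fibre G c)" and "c S \<in> carrier (fibre G c)"
    using S fam by (auto simp: carrier_fibre)
  show "x \<sqsubseteq>\<^bsub>fibre G c\<^esub> c S" if "x \<in> c ` \<S>" for x
    using that bound S fam by (auto simp: le_fibre)
  fix y assume y: "y \<in> Upper (fibre G c) (c ` \<S>)"
  then obtain U where U: "U \<in> subspaces G" "y = c U" by (auto simp: Upper_def carrier_fibre)
  have "T \<subseteq> U" if "T \<in> \<S>" for T
    using Upper_memD[OF y imageI[OF that] car] fam that U le_fibre by blast
  then have "S \<subseteq> U" by (rule extremal[OF U(1)])
  then show "c S \<sqsubseteq>\<^bsub>fibre G c\<^esub> y" using le_fibre[OF S U(1)] U(2) by simp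
qed

lemma greatest_fibre:
  assumes S: "S \<in> subspaces G" and fam: "\<S> \<subseteq> subspaces G"
    and bound: "\<And>T. T \<in> \<S> \<Longrightarrow> S \<subseteq> T"
    and extremal: "\<And>U. U \<in> subspaces G \<Longrightarrow> (\<And>T. T \<in> \<S> \<Longrightarrow> U \<subseteq> T) \<Longrightarrow> U \<subseteq> S"
  shows "greatest (fibre G c) (c S) (Lower (fibre G c) (c ` \<S>))"
proof (rule greatest_LowerI)
  show car: "c ` \<S> \<subseteq> carrier (fibre G c)" and "c S \<in> carrier (fibre G c)"
    using S fam by (auto simp: carrier_fibre)
  show "c S \<sqsubseteq>\<^bsub>fibre G c\<^esub> x" if "x \<in> c ` \<S>" for x
    using that bound S fam by (auto simp: le_fibre)
  fix y assume y: "y \<in> Lower (fibre G c) (c ` \<S>)"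
  then obtain U where U: "U \<in> subspaces G" "y = c U" by (auto simp: Lower_def carrier_fibre)
  have "U \<subseteq> T" if "T \<in> \<S>" for T
    using Lower_memD[OF y imageI[OF that] car] fam that U le_fibre by blast
  then have "U \<subseteq> S" by (rule extremal[OF U(1)])
  then show "y \<sqsubseteq>\<^bsub>fibre G c\<^esub> c S" using le_fibre[OF U(1) S] U(2) by simp
qed

lemma least_span_fibre:
  "\<S> \<subseteq> subspaces G \<Longrightarrow>
    least (fibre G c) (c (span_in G (\<Union> \<S>))) (Upper (fibre G c) (c ` \<S>))"
  using span_in_superset[of "\<Union> \<S>" G]
  by (intro least_fibre span_in_subspace span_in_least) (auto dest: subspacesD(1))

lemma complete_lattice_fibre: "Complete_Lattice.complete_lattice (fibre G c)"
proof (rule partial_order.complete_latticeI[OF partial_order_fibre])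
  fix A assume "A \<subseteq> carrier (fibre G c)"
  then obtain \<S> where S: "\<S> \<subseteq> subspaces G" "A = c ` \<S>"
    unfolding carrier_fibre by (auto simp: subset_image_iff)
  show "\<exists>s. least (fibre G c) s (Upper (fibre G c) A)"
    using least_span_fibre S by blast
  \<comment> \<open>The factor \<open>Pow G\<close> takes care of the empty family, whose infimum is
    the top element.\<close>
  have "Pow G \<inter> \<Inter> \<S> = \<Inter> (insert (Pow G) \<S>)" by simp
  then have "Pow G \<inter> \<Inter> \<S> \<in> subspaces G"
    using S Inter_subspace[of "insert (Pow G) \<S>" G] Pow_subspace[of G G] by auto
  then have "greatest (fibre G c) (c (Pow G \<inter> \<Inter> \<S>)) (Lower (fibre G c) (c ` \<S>))"
    using S by (intro greatest_fibre) (auto dest: subspacesD(1))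
  then show "\<exists>i. greatest (fibre G c) i (Lower (fibre G c) A)" using S by blast
qed

lemma sup_fibre:
  assumes "\<S> \<subseteq> subspaces G"
  shows "\<Squnion>\<^bsub>fibre G c\<^esub> (c ` \<S>) = c (span_in G (\<Union> \<S>))"
  unfolding Lattice.sup_def
  by (rule partial_order.some_least[OF partial_order_fibre least_span_fibre[OF assms]])

lemma join_fibre:
  assumes "S \<in> subspaces G" "T \<in> subspaces G"
  shows "c S \<squnion>\<^bsub>fibre G c\<^esub> c T = c (sum_space S T)"
proof -
  have "least (fibre G c) (c (sum_space S T)) (Upper (fibre G c) (c ` {S, T}))"
    using assms sum_space_upper[OF assms] sum_space_least[of _ G S T]
    by (intro least_fibre sum_space_subspace) auto
  then show ?thesis
    unfolding join_def Lattice.sup_def by (intro partial_order.some_least[OF partial_order_fibre]) simp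
qed

lemma meet_fibre:
  assumes "S \<in> subspaces G" "T \<in> subspaces G"
  shows "c S \<sqinter>\<^bsub>fibre G c\<^esub> c T = c (S \<inter> T)"
proof -
  have "greatest (fibre G c) (c (S \<inter> T)) (Lower (fibre G c) (c ` {S, T}))"
    using assms by (intro greatest_fibre Int_subspace) auto
  then show ?thesis
    unfolding meet_def Lattice.inf_def by (intro partial_order.some_greatest[OF partial_order_fibre]) simp
qed

lemma bottom_fibre: "\<bottom>\<^bsub>fibre G c\<^esub> = c {{}}"
proof -
  have "least (fibre G c) (c {{}}) (carrier (fibre G c))"
    unfolding least_def carrier_fibre
    using empty_subspace[of G] le_fibre[of "{{}}"] by (auto dest: subspacesD(2))
  then show ?thesis
    unfolding bottom_def by (rule partial_order.some_least[OF partial_order_fibre])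
qed

lemma top_fibre: "\<top>\<^bsub>fibre G c\<^esub> = c (Pow G)"
proof -
  have "greatest (fibre G c) (c (Pow G)) (carrier (fibre G c))"
    unfolding greatest_def carrier_fibre
    using Pow_subspace[of G G] le_fibre[of _ "Pow G"] by (auto dest: subspacesD(1))
  then show ?thesis
    unfolding top_def by (rule partial_order.some_greatest[OF partial_order_fibre])
qed

lemma bounded_lattice_fibre: "Lattice.bounded_lattice (fibre G c)"
proof -
  interpret complete_lattice "fibre G c" by (rule complete_lattice_fibre)
  show ?thesis by unfold_locales
qed

lemma modular_lattice_fibre: "modular_lattice (fibre G c)"
  unfolding modular_lattice_def
proof (intro conjI ballI impI)
  show "lattice (fibre G c)" by (rule complete_lattice_lattice[OF complete_lattice_fibre])
  fix x y z assume "x \<in> carrier (fibre G c)" "y \<in> carrier (fibre G c)" "z \<in> carrier (fibre G c)"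
  then obtain S T U where *: "S \<in> subspaces G" "T \<in> subspaces G" "U \<in> subspaces G"
      "x = c S" "y = c T" "z = c U"
    unfolding carrier_fibre by blast
  assume "x \<sqsubseteq>\<^bsub>fibre G c\<^esub> z"
  then have "S \<subseteq> U" using * le_fibre by simp
  then have "sum_space S (T \<inter> U) = sum_space S T \<inter> U" using * by (intro sum_space_modular)
  then show "x \<squnion>\<^bsub>fibre G c\<^esub> (y \<sqinter>\<^bsub>fibre G c\<^esub> z) = (x \<squnion>\<^bsub>fibre G c\<^esub> y) \<sqinter>\<^bsub>fibre G c\<^esub> z"
    using * by (simp add: join_fibre meet_fibre Int_subspace sum_space_subspace)
qed

text \<open>Spans are finitary: the vectors that lie in the span of some finite subfamily already
  form a subspace, which contains every member of the family and hence the whole span.\<close>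

lemma compact_fibre:
  assumes "P \<subseteq> G"
  shows "compact_element (fibre G c) (c {{}, P})"
  unfolding compact_element_def
proof (intro conjI allI impI)
  have P: "{{}, P} \<in> subspaces G" using assms by (auto simp: subspaces_def)
  then show "c {{}, P} \<in> carrier (fibre G c)" by (simp add: carrier_fibre)
  fix A assume A: "A \<subseteq> carrier (fibre G c)" "c {{}, P} \<sqsubseteq>\<^bsub>fibre G c\<^esub> \<Squnion>\<^bsub>fibre G c\<^esub> A"
  then obtain \<S> where S: "\<S> \<subseteq> subspaces G" "A = c ` \<S>"
    unfolding carrier_fibre by (auto simp: subset_image_iff)
  let ?fin = "{Q. \<exists>\<T> \<subseteq> \<S>. finite \<T> \<and> Q \<in> span_in G (\<Union> \<T>)}"
  have span: "span_in G (\<Union> \<T>) \<in> subspaces G" if "\<T> \<subseteq> \<S>" for \<T>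
    using that S subspacesD(1)[of _ G] by (intro span_in_subspace) blast
  have "sym_diff Q R \<in> ?fin" if QR: "Q \<in> ?fin" "R \<in> ?fin" for Q R
  proof -
    obtain \<T> \<U> where *: "\<T> \<subseteq> \<S>" "finite \<T>" "Q \<in> span_in G (\<Union> \<T>)"
        "\<U> \<subseteq> \<S>" "finite \<U>" "R \<in> span_in G (\<Union> \<U>)"
      using QR by blast
    have "span_in G (\<Union> \<T>) \<subseteq> span_in G (\<Union> (\<T> \<union> \<U>))" "span_in G (\<Union> \<U>) \<subseteq> span_in G (\<Union> (\<T> \<union> \<U>))"
      by (auto simp: span_in_def)
    then have "sym_diff Q R \<in> span_in G (\<Union> (\<T> \<union> \<U>))"
      using * subspacesD(3)[OF span[of "\<T> \<union> \<U>"]] by blast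
    then show ?thesis using * by (auto intro!: exI[of _ "\<T> \<union> \<U>"])
  qed
  moreover have "{} \<in> ?fin" using subspacesD(2)[OF span[of "{}"]] by (auto intro!: exI[of _ "{}"])
  moreover have "?fin \<subseteq> Pow G" using subspacesD(1)[OF span] by blast
  ultimately have "?fin \<in> subspaces G" unfolding subspaces_def by blast
  moreover have "\<Union> \<S> \<subseteq> ?fin"
  proof
    fix Q assume "Q \<in> \<Union> \<S>"
    then obtain T where "T \<in> \<S>" "Q \<in> T" by blast
    then show "Q \<in> ?fin" using span_in_superset[of T G] by (auto intro!: exI[of _ "{T}"])
  qed
  ultimately have "span_in G (\<Union> \<S>) \<subseteq> ?fin" by (rule span_in_least)
  moreover have "{{}, P} \<subseteq> span_in G (\<Union> \<S>)"
    using A(2) le_fibre[OF P span[OF subset_refl]] unfolding S(2) sup_fibre[OF S(1)] by blast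
  ultimately obtain \<T> where T: "\<T> \<subseteq> \<S>" "finite \<T>" "P \<in> span_in G (\<Union> \<T>)" by auto
  then have "c {{}, P} \<sqsubseteq>\<^bsub>fibre G c\<^esub> \<Squnion>\<^bsub>fibre G c\<^esub> (c ` \<T>)"
    using S(1) le_fibre[OF P span[OF T(1)]] subspacesD(2)[OF span[OF T(1)]]
    by (subst sup_fibre) auto
  then show "\<exists>B \<subseteq> A. finite B \<and> c {{}, P} \<sqsubseteq>\<^bsub>fibre G c\<^esub> \<Squnion>\<^bsub>fibre G c\<^esub> B"
    using T S(2) by (intro exI[of _ "c ` \<T>"]) auto
qed

text \<open>A subspace is the join of the compact subspaces \<open>{{}, P}\<close> generated by its
  single vectors.\<close>

lemma complete_algebraic_lattice_fibre: "complete_algebraic_lattice (fibre G c)"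
  unfolding complete_algebraic_lattice_def
proof (intro conjI ballI complete_lattice_fibre)
  fix x assume "x \<in> carrier (fibre G c)"
  then obtain S where S: "S \<in> subspaces G" "x = c S" unfolding carrier_fibre by blast
  let ?\<S> = "(\<lambda>P. {{}, P}) ` S"
  have "?\<S> \<subseteq> subspaces G" using subspacesD(1)[OF S(1)] by (auto simp: subspaces_def)
  moreover have "span_in G (\<Union> ?\<S>) = S"
  proof
    show "span_in G (\<Union> ?\<S>) \<subseteq> S" using S subspacesD(2)[OF S(1)] by (intro span_in_least) auto
    show "S \<subseteq> span_in G (\<Union> ?\<S>)" using span_in_superset[of "\<Union> ?\<S>" G] by blast
  qed
  ultimately have "x = \<Squnion>\<^bsub>fibre G c\<^esub> (c ` ?\<S>)" using S(2) sup_fibre by simp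
  moreover have "c ` ?\<S> \<subseteq> {c'. compact_element (fibre G c) c'}"
    using compact_fibre subspacesD(1)[OF S(1)] by auto
  ultimately show "\<exists>A \<subseteq> {c'. compact_element (fibre G c) c'}. x = \<Squnion>\<^bsub>fibre G c\<^esub> A" by blast
qed

end

section \<open>Direct and inverse images of subspaces under the linear map that takes preimages
  along \<open>\<phi>\<close>\<close>

definition push :: "('t \<Rightarrow> 't) \<Rightarrow> 't set \<Rightarrow> 't set set \<Rightarrow> 't set set" where
  "push \<phi> H' S = (\<lambda>P. \<phi> -` P \<inter> H') ` S"

definition pull :: "('t \<Rightarrow> 't) \<Rightarrow> 't set \<Rightarrow> 't set \<Rightarrow> 't set set \<Rightarrow> 't set set" where
  "pull \<phi> H' H T = {P. P \<subseteq> H \<and> \<phi> -` P \<inter> H' \<in> T}"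

lemma push_subspace:
  assumes "S \<in> subspaces H"
  shows "push \<phi> H' S \<in> subspaces H'"
proof -
  have "sym_diff A B \<in> push \<phi> H' S" if AB: "A \<in> push \<phi> H' S" "B \<in> push \<phi> H' S" for A B
  proof -
    obtain P Q where PQ: "A = \<phi> -` P \<inter> H'" "B = \<phi> -` Q \<inter> H'" "P \<in> S" "Q \<in> S"
      using AB unfolding push_def by blast
    have "sym_diff A B = \<phi> -` sym_diff P Q \<inter> H'" unfolding PQ(1,2) by auto
    then show ?thesis
      using subspacesD(3)[OF assms PQ(3,4)] unfolding push_def by (rule image_eqI)
  qed
  moreover have "{} \<in> push \<phi> H' S"
    unfolding push_def using subspacesD(2)[OF assms] by (intro image_eqI[of _ _ "{}"]) auto
  moreover have "push \<phi> H' S \<subseteq> Pow H'" by (auto simp: push_def)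
  ultimately show ?thesis by (simp add: subspaces_def)
qed

lemma pull_subspace:
  assumes "T \<in> subspaces H'"
  shows "pull \<phi> H' H T \<in> subspaces H"
proof -
  have "sym_diff P Q \<in> pull \<phi> H' H T" if PQ: "P \<in> pull \<phi> H' H T" "Q \<in> pull \<phi> H' H T" for P Q
  proof -
    have "\<phi> -` sym_diff P Q \<inter> H' = sym_diff (\<phi> -` P \<inter> H') (\<phi> -` Q \<inter> H')" by auto
    moreover have "\<dots> \<in> T" using PQ by (intro subspacesD(3)[OF assms]) (auto simp: pull_def)
    ultimately have "\<phi> -` sym_diff P Q \<inter> H' \<in> T" by simp
    then show ?thesis using PQ unfolding pull_def by blast
  qed
  moreover have "{} \<in> pull \<phi> H' H T" using subspacesD(2)[OF assms] by (simp add: pull_def)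
  moreover have "pull \<phi> H' H T \<subseteq> Pow H" by (auto simp: pull_def)
  ultimately show ?thesis by (simp add: subspaces_def)
qed

lemma push_subset_iff:
  "S \<subseteq> Pow H \<Longrightarrow> push \<phi> H' S \<subseteq> T \<longleftrightarrow> S \<subseteq> pull \<phi> H' H T"
  unfolding push_def pull_def by blast

lemma push_mono: "S \<subseteq> S' \<Longrightarrow> push \<phi> H' S \<subseteq> push \<phi> H' S'"
  by (auto simp: push_def)

lemma pull_mono: "T \<subseteq> T' \<Longrightarrow> pull \<phi> H' H T \<subseteq> pull \<phi> H' H T'"
  by (auto simp: pull_def)

lemma pull_bot:
  assumes "\<phi> ` H' \<subseteq> H"
  shows "pull \<phi> H' H {{}} = Pow (H - \<phi> ` H')"
  using assms by (auto simp: pull_def)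

text \<open>Two subsets of \<open>H\<close> have the same preimage along \<open>\<phi>\<close>
  exactly when their symmetric difference misses the image of \<open>\<phi>\<close>, that is, when
  they differ by a vector of the kernel.\<close>

lemma pull_push:
  assumes "S \<in> subspaces H" "\<phi> ` H' \<subseteq> H"
  shows "pull \<phi> H' H (push \<phi> H' S) = sum_space S (Pow (H - \<phi> ` H'))"
proof
  show "pull \<phi> H' H (push \<phi> H' S) \<subseteq> sum_space S (Pow (H - \<phi> ` H'))"
  proof
    fix P assume "P \<in> pull \<phi> H' H (push \<phi> H' S)"
    then obtain Q where P: "P \<subseteq> H" and Q: "Q \<in> S" "\<phi> -` P \<inter> H' = \<phi> -` Q \<inter> H'"
      by (auto simp: pull_def push_def)
    have *: "P = sym_diff Q (sym_diff P Q)" by auto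
    have "sym_diff P Q \<subseteq> H" using P Q(1) subspacesD(1)[OF assms(1)] by auto
    moreover have "sym_diff P Q \<inter> \<phi> ` H' = {}" using Q(2) by auto
    ultimately have "sym_diff P Q \<in> Pow (H - \<phi> ` H')" by blast
    then show "P \<in> sum_space S (Pow (H - \<phi> ` H'))"
      using sum_spaceI[OF Q(1), of "sym_diff P Q"] * by metis
  qed
  have "S \<subseteq> pull \<phi> H' H (push \<phi> H' S)"
    using push_subset_iff[OF subspacesD(1)[OF assms(1)]] by blast
  moreover have "Pow (H - \<phi> ` H') \<subseteq> pull \<phi> H' H (push \<phi> H' S)"
    unfolding pull_bot[OF assms(2), symmetric]
    using subspacesD(2)[OF push_subspace[OF assms(1)]] by (intro pull_mono) auto
  ultimately show "sum_space S (Pow (H - \<phi> ` H')) \<subseteq> pull \<phi> H' H (push \<phi> H' S)"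
    by (intro sum_space_least[OF pull_subspace[OF push_subspace[OF assms(1)]]])
qed

lemma push_pull: "push \<phi> H' (pull \<phi> H' H T) = T \<inter> push \<phi> H' (Pow H)"
  by (auto simp: push_def pull_def)

lemma push_comp:
  assumes "\<psi> ` H'' \<subseteq> H'" "\<And>t. t \<in> H'' \<Longrightarrow> \<chi> t = \<phi> (\<psi> t)"
  shows "push \<chi> H'' S = push \<psi> H'' (push \<phi> H' S)"
proof -
  have "\<chi> -` P \<inter> H'' = \<psi> -` (\<phi> -` P \<inter> H') \<inter> H''" for P
    using assms by auto
  then show ?thesis by (simp add: push_def image_image)
qed

lemma pull_comp:
  assumes "\<psi> ` H'' \<subseteq> H'" "\<And>t. t \<in> H'' \<Longrightarrow> \<chi> t = \<phi> (\<psi> t)"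
  shows "pull \<chi> H'' H T = pull \<phi> H' H (pull \<psi> H'' H' T)"
proof -
  have "\<chi> -` P \<inter> H'' = \<psi> -` (\<phi> -` P \<inter> H') \<inter> H''" for P
    using assms by auto
  then show ?thesis by (simp add: pull_def)
qed

lemma push_ident:
  assumes "S \<subseteq> Pow H" "\<And>t. t \<in> H \<Longrightarrow> \<chi> t = t"
  shows "push \<chi> H S = S"
proof -
  have "\<chi> -` P \<inter> H = P" if "P \<in> S" for P using that assms by auto
  then show ?thesis by (simp add: push_def)
qed

lemma pull_ident:
  assumes "T \<subseteq> Pow H" "\<And>t. t \<in> H \<Longrightarrow> \<chi> t = t"
  shows "pull \<chi> H H T = T"
proof -
  have "\<chi> -` P \<inter> H = P" if "P \<subseteq> H" for P using that assms(2) by auto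
  then show ?thesis using assms(1) by (auto simp: pull_def)
qed

text \<open>A set saturated for \<open>\<phi>\<close> is the preimage of its own image. In this
  form, image clusters of different maps are compared through the pairs of terms that the maps
  identify.\<close>

lemma push_top_iff:
  assumes "\<phi> ` H' \<subseteq> H"
  shows "Q \<in> push \<phi> H' (Pow H) \<longleftrightarrow>
    Q \<subseteq> H' \<and> (\<forall>s \<in> H'. \<forall>t \<in> H'. \<phi> s = \<phi> t \<longrightarrow> s \<in> Q \<longrightarrow> t \<in> Q)" (is "?L \<longleftrightarrow> ?R")
proof
  assume R: ?R
  have "\<phi> -` (\<phi> ` Q) \<inter> H' \<subseteq> Q"
  proof
    fix t assume "t \<in> \<phi> -` (\<phi> ` Q) \<inter> H'"
    then obtain s where "s \<in> Q" "\<phi> s = \<phi> t" "t \<in> H'" by auto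
    with R show "t \<in> Q" by blast
  qed
  then have "Q = \<phi> -` (\<phi> ` Q) \<inter> H'" using R by auto
  moreover have "\<phi> ` Q \<in> Pow H" using assms R by auto
  ultimately show ?L unfolding push_def by (rule image_eqI)
qed (auto simp: push_def)

section \<open>Coding in the universe\<close>

text \<open>Subspaces are sets of sets of terms and so do not belong to the universe; they can serve
  as clusters once they are injected into it with a small set of values.\<close>

definition codable :: "('u \<Rightarrow> 'u set) \<Rightarrow> 't set \<Rightarrow> bool" where
  "codable elts G \<longleftrightarrow> (\<exists>e. inj_on e G \<and> small elts (e ` G))"

text \<open>Here \<open>p\<close> is a pairing, \<open>\<sigma>\<close> assigns codes to subsets,
  and \<open>a\<close> and \<open>b\<close> are tags that tell the two constructors apart.\<close>

primrec encode :: "('u \<times> 'u \<Rightarrow> 'u) \<Rightarrow> ('u set \<Rightarrow> 'u) \<Rightarrow> 'u \<Rightarrow> 'u \<Rightarrow> 'u cterm \<Rightarrow> 'u" where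
  "encode p \<sigma> a b (Base S) = p (a, \<sigma> S)"
| "encode p \<sigma> a b (Glue A s B t) =
    p (b, p (p (\<sigma> A, encode p \<sigma> a b s), p (\<sigma> B, encode p \<sigma> a b t)))"

context grothendieck_universe
begin

lemma small_subset: "small elts A \<Longrightarrow> B \<subseteq> A \<Longrightarrow> small elts B"
  using subset_ex unfolding small_def by (metis imageE rangeI)

lemma codable_subset: "codable elts G \<Longrightarrow> G' \<subseteq> G \<Longrightarrow> codable elts G'"
  unfolding codable_def by (meson image_mono inj_on_subset small_subset)

text \<open>A subset of \<open>G\<close> is coded by the set of the universe whose elements are the
  codes of its members; the axiom of power sets bounds these codes.\<close>

lemma codable_Pow:
  assumes "codable elts G"
  shows "codable elts (Pow G)"
proof -
  obtain e x where e: "inj_on e G" "e ` G = elts x"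
    using assms by (auto simp: codable_def small_def)
  define c where "c P = (SOME y. elts y = e ` P)" for P
  have c: "elts (c P) = e ` P" if "P \<subseteq> G" for P
    unfolding c_def using that e(2) by (intro someI_ex[of "\<lambda>y. elts y = e ` P"] subset_ex[of _ x]) auto
  have "inj_on c (Pow G)"
  proof
    fix P Q assume PQ: "P \<in> Pow G" "Q \<in> Pow G" "c P = c Q"
    then have "e ` P = e ` Q" using c by (metis PowD)
    then show "P = Q" using inj_on_image_eq_iff[OF e(1)] PQ by blast
  qed
  moreover obtain z where z: "elts z = {y. elts y \<subseteq> elts x}" using power_ex by blast
  have "elts (c P) \<subseteq> elts x" if "P \<in> Pow G" for P
    using c[of P] that image_mono[of P G e] e(2) by simp
  then have "c ` Pow G \<subseteq> elts z" unfolding z by blast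
  then have "small elts (c ` Pow G)" by (rule small_subset[rotated]) (simp add: small_def)
  ultimately show ?thesis unfolding codable_def by blast
qed

text \<open>A single set \<open>z\<close> of the universe is closed under a pairing and contains
  codes of all subsets of \<open>X\<close>. The recursion \<open>encode\<close> then never leaves
  \<open>z\<close>, so terms of all depths are coded inside one set.\<close>

lemma codable_terms:
  assumes "small elts X" "M \<subseteq> Pow X"
  shows "codable elts {t. valid X M t}"
proof -
  obtain x w where x: "elts x = X" and w: "infinite (elts w)"
    using assms(1) infinite_ex by (auto simp: small_def)
  \<comment> \<open>Adjoining the infinite set \<open>w\<close> makes \<open>z\<close> infinite even
    when \<open>X\<close> is finite, so that \<open>z\<close> is in bijection with its square; this
    bijection is the pairing \<open>p\<close>.\<close>
  obtain q where "elts q = {x, w}" using pair_ex by blast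
  then obtain u where u: "elts u = X \<union> elts w" using Union_ex[where x = q and f = "\<lambda>i. i"] x by auto
  obtain z where z: "elts z = {y. elts y \<subseteq> elts u}" using power_ex by blast
  have "elts ` elts z = Pow (elts u)" unfolding z using subset_ex[of _ u] by auto
  then have inf: "infinite (elts z)" using w u finite_imageI[of "elts z" elts] by auto
  then obtain p where p: "bij_betw p (elts z \<times> elts z) (elts z)"
    using card_of_ordIso[of "elts z \<times> elts z" "elts z"] card_of_Times_same_infinite by blast
  obtain a b where ab: "a \<in> elts z" "b \<in> elts z" "a \<noteq> b"
    using infinite_imp_nonempty[OF inf] infinite_remove[OF inf] infinite_imp_nonempty by blast
  define \<sigma> where "\<sigma> A = (SOME y. elts y = A)" for A
  have \<sigma>: "elts (\<sigma> A) = A" if "A \<subseteq> X" for A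
    unfolding \<sigma>_def using that x by (intro someI_ex[of "\<lambda>y. elts y = A"] subset_ex[of _ x]) auto
  have \<sigma>z: "\<sigma> A \<in> elts z" if "A \<subseteq> X" for A using \<sigma>[OF that] that unfolding z u by auto
  have \<sigma>_inj: "\<sigma> A = \<sigma> B \<longleftrightarrow> A = B" if "A \<subseteq> X" "B \<subseteq> X" for A B using \<sigma> that by metis
  have pz: "p (c, d) \<in> elts z" if "c \<in> elts z" "d \<in> elts z" for c d
    using that p by (auto dest: bij_betwE)
  have p_inj: "p (c, d) = p (c', d') \<longleftrightarrow> c = c' \<and> d = d'"
    if "c \<in> elts z" "d \<in> elts z" "c' \<in> elts z" "d' \<in> elts z" for c d c' d'
    using that p by (auto simp: bij_betw_def inj_on_def)
  have ez: "encode p \<sigma> a b t \<in> elts z" if "valid X M t" for t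
    using that
  proof (induction t)
    case (Base S)
    then show ?case using assms(2) ab by (auto intro!: pz \<sigma>z)
  next
    case (Glue A s B t)
    then show ?case using ab by (auto intro!: pz \<sigma>z)
  qed
  have "s = t" if "valid X M s" "valid X M t" "encode p \<sigma> a b s = encode p \<sigma> a b t" for s t
    using that
  proof (induction s arbitrary: t)
    case (Base S)
    show ?case
    proof (cases t)
      case (Base T)
      have "S \<subseteq> X" "T \<subseteq> X" using Base.prems Base assms(2) by auto
      then show ?thesis using Base.prems(3) Base ab by (simp add: p_inj \<sigma>z \<sigma>_inj)
    next
      case (Glue A u B v)
      have "S \<subseteq> X" "A \<subseteq> X" "B \<subseteq> X" "valid X M u" "valid X M v" using Base.prems Glue assms(2) by auto
      then show ?thesis using Base.prems(3) Glue ab by (simp add: p_inj pz \<sigma>z ez)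
    qed
  next
    case G: (Glue A u B v)
    have *: "A \<subseteq> X" "B \<subseteq> X" "valid X M u" "valid X M v" using G.prems by auto
    show ?case
    proof (cases t)
      case (Base S)
      have "S \<subseteq> X" using G.prems Base assms(2) by auto
      then show ?thesis using G.prems(3) Base ab * by (simp add: p_inj pz \<sigma>z ez)
    next
      case (Glue A' u' B' v')
      have "A' \<subseteq> X" "B' \<subseteq> X" "valid X M u'" "valid X M v'" using G.prems Glue by auto
      then show ?thesis using G.prems(3) Glue ab * G.IH[of u'] G.IH(2)[of v']
        by (simp add: p_inj pz \<sigma>z ez \<sigma>_inj)
    qed
  qed
  then have "inj_on (encode p \<sigma> a b) {t. valid X M t}" by (auto simp: inj_on_def)
  moreover have "encode p \<sigma> a b ` {t. valid X M t} \<subseteq> elts z" using ez by auto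
  then have "small elts (encode p \<sigma> a b ` {t. valid X M t})"
    by (rule small_subset[rotated]) (simp add: small_def)
  ultimately show ?thesis unfolding codable_def by blast
qed

end

section \<open>Factorizations of measurable maps\<close>

definition terms :: "'u mspace \<Rightarrow> 'u cterm set" where
  "terms X = {t. valid (pts X) (msets X) t}"

definition pb :: "'u mmap \<Rightarrow> 'u cterm \<Rightarrow> 'u cterm" where
  "pb f = pullback (pts (dom_sp f)) (fun_of f)"

definition incl :: "'u mspace \<Rightarrow> 'u set \<Rightarrow> 'u mmap" where
  "incl X A = ((A, (\<lambda>B. A \<inter> B) ` msets X), restrict (\<lambda>x. x) A, X)"

text \<open>The coding is chosen once for each space, so that all maps into and out of the space
  refer to the same clusters. That a suitable coding exists follows from
  \<open>codable_terms\<close> and \<open>codable_Pow\<close>.\<close>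

definition code :: "('u \<Rightarrow> 'u set) \<Rightarrow> 'u mspace \<Rightarrow> 'u cterm set set \<Rightarrow> 'u" where
  "code elts X = (SOME c. inj_on c (subspaces (terms X)) \<and> small elts (c ` subspaces (terms X)))"

definition decode :: "('u \<Rightarrow> 'u set) \<Rightarrow> 'u mspace \<Rightarrow> 'u \<Rightarrow> 'u cterm set set" where
  "decode elts X = inv_into (subspaces (terms X)) (code elts X)"

definition meas_form :: "('u \<Rightarrow> 'u set) \<Rightarrow> ('u mspace, 'u mmap, 'u) form" where
  "meas_form elts =
     \<lparr>Fib = (\<lambda>X. fibre (terms X) (code elts X)),
      Dir = (\<lambda>f a. code elts (cod_sp f) (push (pb f) (terms (cod_sp f)) (decode elts (dom_sp f) a))),
      Inv = (\<lambda>f b. code elts (dom_sp f)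
        (pull (pb f) (terms (cod_sp f)) (terms (dom_sp f)) (decode elts (cod_sp f) b)))\<rparr>"

lemma Meas_simps [simp]:
  "Obj (Meas elts) = meas_spaces elts" "Arr (Meas elts) = meas_maps elts"
  "Dom (Meas elts) = dom_sp" "Cod (Meas elts) = cod_sp"
  "dom_sp (Comp (Meas elts) g f) = dom_sp f" "cod_sp (Comp (Meas elts) g f) = cod_sp g"
  "dom_sp (Id (Meas elts) X) = X" "cod_sp (Id (Meas elts) X) = X"
  "fun_of (Id (Meas elts) X) = restrict (\<lambda>x. x) (pts X)"
  by (simp_all add: Meas_def)

lemma fun_of_Comp [simp]:
  "fun_of (Comp (Meas elts) g f) = compose (pts (dom_sp f)) (fun_of g) (fun_of f)"
  by (simp add: Meas_def)

lemma Hom_Meas: "f \<in> Hom (Meas elts) X Y \<longleftrightarrow> f \<in> meas_maps elts \<and> dom_sp f = X \<and> cod_sp f = Y"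
  by (simp add: Hom_def)

lemma meas_mapsD:
  assumes "f \<in> meas_maps elts"
  shows "dom_sp f \<in> meas_spaces elts" "cod_sp f \<in> meas_spaces elts"
    "fun_of f ` pts (dom_sp f) \<subseteq> pts (cod_sp f)"
    "B \<in> msets (cod_sp f) \<Longrightarrow> fun_of f -` B \<inter> pts (dom_sp f) \<in> msets (dom_sp f)"
    "fun_of f \<in> extensional (pts (dom_sp f))"
  using assms by (auto simp: meas_maps_def PiE_def)

lemma meas_map_eqI:
  assumes "f \<in> meas_maps elts" "g \<in> meas_maps elts" "dom_sp f = dom_sp g" "cod_sp f = cod_sp g"
    "\<And>x. x \<in> pts (dom_sp f) \<Longrightarrow> fun_of f x = fun_of g x"
  shows "f = g"
proof -
  have "fun_of f = fun_of g"
    using assms meas_mapsD(5)[OF assms(1)] meas_mapsD(5)[OF assms(2)]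
    by (intro extensionalityI[of _ "pts (dom_sp f)"]) auto
  then show ?thesis using assms by (simp add: prod_eq_iff)
qed

lemma Comp_meas_maps:
  "f \<in> meas_maps elts \<Longrightarrow> g \<in> meas_maps elts \<Longrightarrow> cod_sp f = dom_sp g \<Longrightarrow>
    Comp (Meas elts) g f \<in> meas_maps elts"
  using category.Comp_Hom[OF category_Meas, of f elts "dom_sp f" "dom_sp g" g "cod_sp g"]
  by (simp add: Hom_Meas)

lemma Id_meas_maps: "X \<in> meas_spaces elts \<Longrightarrow> Id (Meas elts) X \<in> meas_maps elts"
  using category.Id_Hom[OF category_Meas, of X elts] by (simp add: Hom_Meas)

lemma meas_spaces_sets: "X \<in> meas_spaces elts \<Longrightarrow> msets X \<subseteq> Pow (pts X)"
  unfolding meas_spaces_def mem_Collect_eq sigma_algebra_iff2 by blast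

section \<open>The contravariant action of measurable maps on terms\<close>

lemma pb_terms: "f \<in> meas_maps elts \<Longrightarrow> t \<in> terms (cod_sp f) \<Longrightarrow> pb f t \<in> terms (dom_sp f)"
  unfolding terms_def pb_def mem_Collect_eq by (rule valid_pullback) (auto dest: meas_mapsD)

lemma pb_image: "f \<in> meas_maps elts \<Longrightarrow> pb f ` terms (cod_sp f) \<subseteq> terms (dom_sp f)"
  using pb_terms by blast

lemma pb_Comp:
  assumes "f \<in> meas_maps elts" "g \<in> meas_maps elts" "cod_sp f = dom_sp g" "t \<in> terms (cod_sp g)"
  shows "pb (Comp (Meas elts) g f) t = pb f (pb g t)"
proof -
  have "pb f (pb g t) = pullback (pts (dom_sp f)) (fun_of g \<circ> fun_of f) t"
    unfolding pb_def using assms meas_mapsD(3)[OF assms(1)] meas_mapsD(3)[OF assms(2)]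
    by (intro pullback_pullback) (auto simp: terms_def)
  also have "\<dots> = pb (Comp (Meas elts) g f) t"
    unfolding pb_def by (simp, rule pullback_cong) (simp add: compose_def)
  finally show ?thesis by simp
qed

lemma pb_Id:
  assumes "X \<in> meas_spaces elts" "t \<in> terms X"
  shows "pb (Id (Meas elts) X) t = t"
proof -
  have "pb (Id (Meas elts) X) t = restr (pts X) t"
    unfolding pb_def by (simp, rule pullback_cong) simp
  then show ?thesis
    using assms restr_self[OF meas_spaces_sets[OF assms(1)]] by (simp add: terms_def)
qed

lemma pb_inj:
  assumes "f \<in> surjective_meas_maps elts"
  shows "inj_on (pb f) (terms (cod_sp f))"
proof
  have f: "f \<in> meas_maps elts" "fun_of f ` pts (dom_sp f) = pts (cod_sp f)"
    using assms by (auto simp: surjective_meas_maps_def)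
  fix s t assume "s \<in> terms (cod_sp f)" "t \<in> terms (cod_sp f)" "pb f s = pb f t"
  then show "s = t"
    unfolding pb_def terms_def
    using pullback_inj_iff[OF _ _ f(2) meas_spaces_sets[OF meas_mapsD(2)[OF f(1)]]] by blast
qed

lemma pb_surj:
  assumes "f \<in> injective_trace_meas_maps elts"
  shows "pb f ` terms (cod_sp f) = terms (dom_sp f)"
proof
  have f: "f \<in> meas_maps elts" "inj_on (fun_of f) (pts (dom_sp f))"
      "msets (dom_sp f) = {fun_of f -` B \<inter> pts (dom_sp f) |B. B \<in> msets (cod_sp f)}"
    using assms by (simp_all add: injective_trace_meas_maps_def)
  show "pb f ` terms (cod_sp f) \<subseteq> terms (dom_sp f)" using pb_image f(1) .
  show "terms (dom_sp f) \<subseteq> pb f ` terms (cod_sp f)"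
  proof
    fix t assume "t \<in> terms (dom_sp f)"
    then have "valid (pts (dom_sp f)) (msets (dom_sp f)) t" by (simp add: terms_def)
    from pullback_surj[OF this f(2) meas_mapsD(3)[OF f(1)] f(3)]
    obtain t' where "valid (pts (cod_sp f)) (msets (cod_sp f)) t'"
        "pullback (pts (dom_sp f)) (fun_of f) t' = t" .
    then show "t \<in> pb f ` terms (cod_sp f)" by (auto simp: pb_def terms_def)
  qed
qed

section \<open>Initial and quotient sigma-algebras\<close>

lemma sigma_algebra_vimage:
  assumes "sigma_algebra Y N" "f ` X \<subseteq> Y"
  shows "sigma_algebra X {f -` B \<inter> X | B. B \<in> N}"
  unfolding sigma_algebra_iff2
proof (intro conjI ballI allI impI)
  interpret sigma_algebra Y N by fact
  show "{} \<in> {f -` B \<inter> X | B. B \<in> N}" using empty_sets by force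
  fix S assume "S \<in> {f -` B \<inter> X | B. B \<in> N}"
  then obtain B where B: "B \<in> N" "S = f -` B \<inter> X" by blast
  have "X - S = f -` (Y - B) \<inter> X" using B(2) assms(2) by auto
  then show "X - S \<in> {f -` B \<inter> X | B. B \<in> N}" using compl_sets[OF B(1)] by blast
next
  interpret sigma_algebra Y N by fact
  fix S :: "nat \<Rightarrow> 'b set" assume "range S \<subseteq> {f -` B \<inter> X | B. B \<in> N}"
  then have "\<forall>i. \<exists>B. B \<in> N \<and> S i = f -` B \<inter> X" by blast
  then obtain B where B: "\<And>i. B i \<in> N" "\<And>i. S i = f -` B i \<inter> X" by metis
  have "(\<Union>i. S i) = f -` (\<Union>i. B i) \<inter> X" unfolding B(2) by auto
  moreover have "(\<Union>i. B i) \<in> N" using B(1) by blast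
  ultimately show "(\<Union>i. S i) \<in> {f -` B \<inter> X | B. B \<in> N}" by blast
qed auto

lemma sigma_algebra_Int:
  "sigma_algebra X M \<Longrightarrow> sigma_algebra X N \<Longrightarrow> sigma_algebra X (M \<inter> N)"
  by (simp add: sigma_algebra_iff2 le_infI1)

text \<open>This is the quotient sigma-algebra, the largest one on the image for which
  \<open>r\<close> is measurable.\<close>

lemma sigma_algebra_image:
  assumes "sigma_algebra X M"
  shows "sigma_algebra (r ` X) {S. S \<subseteq> r ` X \<and> r -` S \<inter> X \<in> M}"
  unfolding sigma_algebra_iff2
proof (intro conjI ballI allI impI)
  interpret sigma_algebra X M by fact
  show "{} \<in> {S. S \<subseteq> r ` X \<and> r -` S \<inter> X \<in> M}" by simp
  fix S assume "S \<in> {S. S \<subseteq> r ` X \<and> r -` S \<inter> X \<in> M}"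
  moreover have "r -` (r ` X - S) \<inter> X = X - r -` S \<inter> X" by auto
  ultimately show "r ` X - S \<in> {S. S \<subseteq> r ` X \<and> r -` S \<inter> X \<in> M}" using compl_sets by auto
next
  interpret sigma_algebra X M by fact
  fix S :: "nat \<Rightarrow> 'b set" assume S: "range S \<subseteq> {S. S \<subseteq> r ` X \<and> r -` S \<inter> X \<in> M}"
  have "r -` (\<Union>i. S i) \<inter> X = (\<Union>i. r -` S i \<inter> X)" by auto
  moreover have "(\<Union>i. r -` S i \<inter> X) \<in> M" using S by (intro countable_nat_UN) blast
  ultimately show "(\<Union>i. S i) \<in> {S. S \<subseteq> r ` X \<and> r -` S \<inter> X \<in> M}" using S by auto
qed auto

section \<open>Factorizations through images, quotients and embeddings\<close>

lemma (in grothendieck_universe) incl_trace: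
  assumes X: "X \<in> meas_spaces elts" and A: "A \<subseteq> pts X"
  shows "incl X A \<in> injective_trace_meas_maps elts"
proof -
  interpret sigma_algebra "pts X" "msets X" using X by (simp add: meas_spaces_def)
  have "(\<lambda>B. A \<inter> B) ` msets X = {(\<lambda>x. x) -` B \<inter> A | B. B \<in> msets X}" by auto
  then have sub: "(A, (\<lambda>B. A \<inter> B) ` msets X) \<in> meas_spaces elts"
    using X A small_subset[of "pts X" A] sigma_algebra_vimage[of "pts X" "msets X" "\<lambda>x. x" A]
    by (simp add: meas_spaces_def)
  have vim: "restrict (\<lambda>x. x) A -` B \<inter> A = A \<inter> B" for B by auto
  show ?thesis
    using X A sub unfolding injective_trace_meas_maps_def meas_maps_def incl_def
    by (auto simp: vim inj_on_def)
qed

text \<open>The middle object is the set-theoretic image with the trace sigma-algebra; cutting a set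
  down to the image does not change its preimage under \<open>f\<close>. The right factor is a
  concrete inclusion, so that image clusters are indexed by subsets.\<close>

lemma image_factorization:
  assumes U: "grothendieck_universe elts" and f: "f \<in> meas_maps elts"
  defines "m \<equiv> incl (cod_sp f) (fun_of f ` pts (dom_sp f))"
  obtains e where "e \<in> surjective_meas_maps elts" "m \<in> injective_trace_meas_maps elts"
    "dom_sp e = dom_sp f" "cod_sp m = cod_sp f" "cod_sp e = dom_sp m" "f = Comp (Meas elts) m e"
proof -
  interpret grothendieck_universe elts by (rule U)
  let ?A = "fun_of f ` pts (dom_sp f)"
  define e where "e = (dom_sp f, fun_of f, dom_sp m)"
  have m: "m \<in> injective_trace_meas_maps elts"
    unfolding m_def by (rule incl_trace[OF meas_mapsD(2,3)[OF f]])
  then have mm: "m \<in> meas_maps elts" by (simp add: injective_trace_meas_maps_def)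
  have vim: "fun_of f -` (?A \<inter> B) \<inter> pts (dom_sp f) = fun_of f -` B \<inter> pts (dom_sp f)" for B by auto
  have e: "e \<in> surjective_meas_maps elts"
    using meas_mapsD[OF f] meas_mapsD(1)[OF mm] vim
    unfolding surjective_meas_maps_def meas_maps_def e_def m_def incl_def
    by (auto simp: PiE_def)
  have "f = Comp (Meas elts) m e"
    using e mm f Comp_meas_maps[of e elts m]
    by (intro meas_map_eqI[of _ elts])
      (auto simp: surjective_meas_maps_def e_def m_def incl_def compose_def)
  then show ?thesis by (intro that[OF e m]) (simp_all add: e_def m_def incl_def)
qed

text \<open>The two kinds of terms do two different jobs. Gluings over arbitrary proper subsets show
  that \<open>g\<close> is constant on the fibres of \<open>p\<close>, so that a function
  \<open>h\<close> exists; base terms show that \<open>h\<close> is measurable.\<close>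

lemma surjective_factor:
  assumes p: "p \<in> surjective_meas_maps elts" and g: "g \<in> meas_maps elts" and dom: "dom_sp g = dom_sp p"
    and pb: "pb g ` terms (cod_sp g) \<subseteq> pb p ` terms (cod_sp p)"
  obtains h where "h \<in> meas_maps elts" "dom_sp h = cod_sp p" "cod_sp h = cod_sp g"
    "g = Comp (Meas elts) h p"
proof -
  let ?X = "pts (dom_sp p)" and ?P = "pts (cod_sp p)" and ?G = "pts (cod_sp g)"
  have p': "p \<in> meas_maps elts" "fun_of p ` ?X = ?P"
    using p by (auto simp: surjective_meas_maps_def)
  have gX: "fun_of g ` ?X \<subseteq> ?G" using meas_mapsD(3)[OF g] dom by simp
  have lift: "\<exists>s. valid ?P (msets (cod_sp p)) s \<and> pullback ?X (fun_of p) s = pullback ?X (fun_of g) t"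
    if "valid ?G (msets (cod_sp g)) t" for t
    using pb that dom unfolding terms_def pb_def by fastforce
  have empty: "{} \<in> msets (cod_sp g)"
    using meas_mapsD(2)[OF g] by (simp add: meas_spaces_def sigma_algebra_iff2)
  have const: "fun_of g x = fun_of g y" if xy: "x \<in> ?X" "y \<in> ?X" "fun_of p x = fun_of p y" for x y
  proof (rule ccontr)
    assume neq: "fun_of g x \<noteq> fun_of g y"
    let ?A = "{fun_of g x}" \<comment> \<open>not measurable in general, which \<open>Glue\<close> does not require\<close>
    have "fun_of g x \<in> ?G" "fun_of g y \<in> ?G" using gX xy by blast+
    then have "?A \<subseteq> ?G" "?A \<noteq> ?G" using neq by (blast, metis singletonD)
    then have A: "?A \<subset> ?G" by (rule psubsetI)
    have nA: "\<not> fun_of g ` ?X \<subseteq> ?A"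
    proof
      assume "fun_of g ` ?X \<subseteq> ?A"
      then have "fun_of g y \<in> ?A" using imageI[OF xy(2)] by (rule subsetD)
      then show False using neq by simp
    qed
    \<comment> \<open>This gluing has equal sides but still records the set \<open>?A\<close>. The
      inclusion of pulled back terms forces the preimage of \<open>?A\<close> under \<open>g\<close>
      to be a preimage under \<open>p\<close> as well, although \<open>?A\<close> separates the
      values of \<open>g\<close> at \<open>x\<close> and \<open>y\<close>.\<close>
    have "valid ?G (msets (cod_sp g)) (Glue ?A (Base {}) ?A (Base {}))" using A empty by simp
    then obtain s where s: "valid ?P (msets (cod_sp p)) s"
        "pullback ?X (fun_of p) s = pullback ?X (fun_of g) (Glue ?A (Base {}) ?A (Base {}))"
      using lift by blast
    then have "pullback ?X (fun_of p) s = Glue (fun_of g -` ?A \<inter> ?X) (Base {}) (fun_of g -` ?A \<inter> ?X) (Base {})"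
      using nA by simp
    from pullback_eq_Glue[OF s(1) p'(2) this]
    obtain A' where A': "fun_of g -` ?A \<inter> ?X = fun_of p -` A' \<inter> ?X" by metis
    have "fun_of g z \<in> ?A \<longleftrightarrow> fun_of p z \<in> A'" if "z \<in> ?X" for z using A' that by blast
    from this[OF xy(1)] this[OF xy(2)] show False using xy(3) neq by simp
  qed
  define h where "h = (cod_sp p, restrict (\<lambda>z. fun_of g (SOME x. x \<in> ?X \<and> fun_of p x = z)) ?P, cod_sp g)"
  have hp: "fun_of h (fun_of p x) = fun_of g x" if "x \<in> ?X" for x
  proof -
    have "\<exists>y. y \<in> ?X \<and> fun_of p y = fun_of p x" using that by blast
    from someI_ex[OF this] have "fun_of g (SOME y. y \<in> ?X \<and> fun_of p y = fun_of p x) = fun_of g x"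
      using const that by blast
    then show ?thesis using that p'(2) by (auto simp: h_def)
  qed
  have "fun_of h -` B \<inter> ?P \<in> msets (cod_sp p)" if B: "B \<in> msets (cod_sp g)" for B
  proof -
    have "valid ?G (msets (cod_sp g)) (Base B)" using B by simp
    then obtain s where s: "valid ?P (msets (cod_sp p)) s"
        "pullback ?X (fun_of p) s = Base (fun_of g -` B \<inter> ?X)"
      using lift[of "Base B"] by auto
    from pullback_eq_Base[OF s(1) p'(2) s(2)] obtain S where S: "S \<in> msets (cod_sp p)"
        "fun_of g -` B \<inter> ?X = fun_of p -` S \<inter> ?X" by metis
    have "S \<subseteq> ?P" using S(1) meas_spaces_sets[OF meas_mapsD(2)[OF p'(1)]] by auto
    have "fun_of h -` B \<inter> ?P = S"
    proof -
      have "z \<in> S \<longleftrightarrow> fun_of h z \<in> B" if "z \<in> ?P" for z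
      proof -
        have "z \<in> fun_of p ` ?X" using that by (simp only: p'(2))
        then obtain x where x: "z = fun_of p x" "x \<in> ?X" by (rule imageE)
        have "x \<in> fun_of g -` B \<inter> ?X \<longleftrightarrow> x \<in> fun_of p -` S \<inter> ?X" by (simp only: S(2))
        then show ?thesis using x hp[OF x(2)] by simp
      qed
      then show ?thesis using \<open>S \<subseteq> ?P\<close> by auto
    qed
    then show ?thesis using S(1) by simp
  qed
  moreover have "fun_of h \<in> ?P \<rightarrow>\<^sub>E ?G"
  proof -
    have "fun_of h z \<in> ?G" if "z \<in> ?P" for z
    proof -
      have "z \<in> fun_of p ` ?X" using that by (simp only: p'(2))
      then obtain x where x: "z = fun_of p x" "x \<in> ?X" by (rule imageE)
      show ?thesis using subsetD[OF gX imageI[OF x(2)]] hp[OF x(2)] x(1) by simp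
    qed
    then show ?thesis by (auto simp: h_def)
  qed
  ultimately have h: "h \<in> meas_maps elts"
    using meas_mapsD(2)[OF g] meas_mapsD(2)[OF p'(1)] unfolding meas_maps_def by (simp add: h_def)
  have "g = Comp (Meas elts) h p"
    using hp Comp_meas_maps[OF p'(1) h] dom
    by (intro meas_map_eqI[OF g]) (auto simp: h_def compose_def)
  then show ?thesis by (intro that[OF h]) (simp_all add: h_def)
qed

lemma injective_trace_factor:
  assumes m: "m \<in> injective_trace_meas_maps elts" and f: "f \<in> meas_maps elts" and cod: "cod_sp f = cod_sp m"
    and sub: "fun_of f ` pts (dom_sp f) \<subseteq> fun_of m ` pts (dom_sp m)"
  obtains h where "h \<in> meas_maps elts" "dom_sp h = dom_sp f" "cod_sp h = dom_sp m"
    "f = Comp (Meas elts) m h"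
proof -
  let ?Z = "pts (dom_sp f)" and ?A = "pts (dom_sp m)"
  have m': "m \<in> meas_maps elts" "inj_on (fun_of m) ?A"
      "msets (dom_sp m) = {fun_of m -` B \<inter> ?A |B. B \<in> msets (cod_sp m)}"
    using m by (simp_all add: injective_trace_meas_maps_def)
  define h where "h = (dom_sp f, restrict (\<lambda>z. inv_into ?A (fun_of m) (fun_of f z)) ?Z, dom_sp m)"
  have hm: "fun_of h z \<in> ?A" "fun_of m (fun_of h z) = fun_of f z" if "z \<in> ?Z" for z
    using that sub inv_into_into[of "fun_of f z" "fun_of m" ?A] f_inv_into_f[of "fun_of f z" "fun_of m" ?A]
    by (auto simp: h_def)
  \<comment> \<open>By the trace hypothesis every measurable set of the domain of \<open>m\<close>
    is a preimage under \<open>m\<close>, so this computes all the preimages under \<open>h\<close>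
    that have to be measurable.\<close>
  have "fun_of h -` (fun_of m -` B \<inter> ?A) \<inter> ?Z = fun_of f -` B \<inter> ?Z" for B
    using hm by auto
  then have h: "h \<in> meas_maps elts"
    using meas_mapsD(1)[OF f] meas_mapsD(1)[OF m'(1)] hm(1) meas_mapsD(4)[OF f] m'(3) cod
    unfolding meas_maps_def by (auto simp: h_def)
  have "f = Comp (Meas elts) m h"
    using hm(2) Comp_meas_maps[OF h m'(1)] cod
    by (intro meas_map_eqI[OF f]) (auto simp: h_def compose_def)
  then show ?thesis by (intro that[OF h]) (simp_all add: h_def)
qed

section \<open>Intersection of the terms of two quotients\<close>

lemma pullback_through:
  assumes f: "f ` X = Y1" and N1: "N1 \<subseteq> Pow Y1" and r: "r ` X \<subseteq> Y"
    and const: "\<And>x y. x \<in> X \<Longrightarrow> y \<in> X \<Longrightarrow> f x = f y \<Longrightarrow> r x = r y"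
    and meas: "\<And>B. B \<in> N \<Longrightarrow> \<exists>S \<in> N1. r -` B \<inter> X = f -` S \<inter> X"
    and t: "valid Y N t"
  obtains t1 where "valid Y1 N1 t1" "pullback X f t1 = pullback X r t"
proof -
  \<comment> \<open>\<open>k\<close> is the factor of \<open>r\<close> through \<open>f\<close>; by
    \<open>const\<close> the choice of the preimage does not affect the value.\<close>
  define k where "k z = r (SOME x. x \<in> X \<and> f x = z)" for z
  have k: "k (f x) = r x" if "x \<in> X" for x
  proof -
    have "\<exists>y. y \<in> X \<and> f y = f x" using that by blast
    from someI_ex[OF this] show ?thesis unfolding k_def using const that by blast
  qed
  have kY: "k ` Y1 \<subseteq> Y" using k r f by auto
  have "k -` B \<inter> Y1 \<in> N1" if B: "B \<in> N" for B
  proof -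
    obtain S where S: "S \<in> N1" "r -` B \<inter> X = f -` S \<inter> X" using meas[OF B] by blast
    have "f x \<in> S \<longleftrightarrow> k (f x) \<in> B" if "x \<in> X" for x using S(2) that k[OF that] by auto
    moreover have "S \<subseteq> Y1" using S(1) N1 by auto
    ultimately have "k -` B \<inter> Y1 = S" using f by auto
    then show ?thesis using S(1) by simp
  qed
  then have "valid Y1 N1 (pullback Y1 k t)" using valid_pullback[OF t kY] by blast
  moreover have "pullback X f (pullback Y1 k t) = pullback X (k \<circ> f) t"
    using pullback_pullback[OF t _ kY] f by simp
  moreover have "\<dots> = pullback X r t" by (rule pullback_cong) (simp add: k)
  ultimately show ?thesis using that by simp
qed

text \<open>The space is the pushout of the two quotient sets under \<open>X\<close>; a set in it is
  measurable when its preimage in \<open>X\<close> comes from measurable sets of both quotients.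
  Terms of the pushout come from both quotients by \<open>pullback_through\<close>, and
  \<open>pullback_common\<close> gives the converse.\<close>

lemma common_quotient:
  assumes U: "grothendieck_universe elts"
    and e1: "e1 \<in> surjective_meas_maps elts" "dom_sp e1 = X"
    and e2: "e2 \<in> surjective_meas_maps elts" "dom_sp e2 = X"
  obtains r where "r \<in> surjective_meas_maps elts" "dom_sp r = X"
    "pb r ` terms (cod_sp r) = pb e1 ` terms (cod_sp e1) \<inter> pb e2 ` terms (cod_sp e2)"
proof -
  interpret grothendieck_universe elts by (rule U)
  let ?f = "fun_of e1" and ?g = "fun_of e2" and ?X = "pts X"
    and ?Y1 = "pts (cod_sp e1)" and ?Y2 = "pts (cod_sp e2)"
    and ?N1 = "msets (cod_sp e1)" and ?N2 = "msets (cod_sp e2)"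
  have m1: "e1 \<in> meas_maps elts" "?f ` ?X = ?Y1" and m2: "e2 \<in> meas_maps elts" "?g ` ?X = ?Y2"
    using e1 e2 by (auto simp: surjective_meas_maps_def)
  have N1: "?N1 \<subseteq> Pow ?Y1" and N2: "?N2 \<subseteq> Pow ?Y2"
    using meas_spaces_sets meas_mapsD(2) m1(1) m2(1) by blast+
  \<comment> \<open>Two points are identified when no set saturated for both maps separates them; \<open>r\<close> picks
    representatives of the classes.\<close>
  define \<A> where "\<A> = {A. A \<subseteq> ?X \<and> ?f -` ?f ` A \<inter> ?X = A \<and> ?g -` ?g ` A \<inter> ?X = A}"
  define r where "r x = (SOME y. y \<in> ?X \<and> (\<forall>A \<in> \<A>. x \<in> A \<longleftrightarrow> y \<in> A))" for x
  have r: "r x \<in> ?X \<and> (\<forall>A \<in> \<A>. x \<in> A \<longleftrightarrow> r x \<in> A)" if "x \<in> ?X" for x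
    unfolding r_def by (rule someI[of _ x]) (use that in simp)
  have r_eq: "r x = r y" if "\<And>A. A \<in> \<A> \<Longrightarrow> x \<in> A \<longleftrightarrow> y \<in> A" for x y
    unfolding r_def using that by metis
  have fib: "y \<in> A" if "h -` h ` A \<inter> ?X = A" "y \<in> ?X" "h x = h y" "x \<in> A" for A x y and h :: "'a \<Rightarrow> 'a"
  proof -
    have "y \<in> h -` h ` A \<inter> ?X" using that(2-4) by (metis IntI imageI vimageI2)
    then show ?thesis using that(1) by simp
  qed
  have rf: "r x = r y" if "x \<in> ?X" "y \<in> ?X" "?f x = ?f y" for x y
  proof (rule r_eq)
    fix A assume "A \<in> \<A>"
    then have "?f -` ?f ` A \<inter> ?X = A" by (simp add: \<A>_def)
    from fib[OF this that(2,3)] fib[OF this that(1) that(3)[symmetric]] show "x \<in> A \<longleftrightarrow> y \<in> A" ..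
  qed
  have rg: "r x = r y" if "x \<in> ?X" "y \<in> ?X" "?g x = ?g y" for x y
  proof (rule r_eq)
    fix A assume "A \<in> \<A>"
    then have "?g -` ?g ` A \<inter> ?X = A" by (simp add: \<A>_def)
    from fib[OF this that(2,3)] fib[OF this that(1) that(3)[symmetric]] show "x \<in> A \<longleftrightarrow> y \<in> A" ..
  qed
  have sat: "r -` r ` A \<inter> ?X = A" if "A \<subseteq> ?X" "?f -` ?f ` A \<inter> ?X = A" "?g -` ?g ` A \<inter> ?X = A" for A
  proof -
    have A: "A \<in> \<A>" using that by (simp add: \<A>_def)
    have "y \<in> A" if "y \<in> ?X" "x \<in> A" "r y = r x" for x y
      using r[OF that(1)] r[of x] A that \<open>A \<subseteq> ?X\<close> by auto
    then show ?thesis using that(1) by auto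
  qed
  \<comment> \<open>Representatives are taken inside \<open>X\<close>, so \<open>Y\<close> is a
    subset of a small set and therefore small.\<close>
  define Y where "Y = r ` ?X"
  define N where "N = {S. S \<subseteq> Y \<and> (\<exists>S1 \<in> ?N1. r -` S \<inter> ?X = ?f -` S1 \<inter> ?X) \<and>
                    (\<exists>S2 \<in> ?N2. r -` S \<inter> ?X = ?g -` S2 \<inter> ?X)}"
  \<comment> \<open>\<open>\<Sigma>\<close> is the intersection of the sigma-algebras that the two
    quotients induce on \<open>X\<close>, and \<open>N\<close> is its quotient sigma-algebra under
    \<open>r\<close>.\<close>
  define \<Sigma> where "\<Sigma> = {?f -` S \<inter> ?X |S. S \<in> ?N1} \<inter> {?g -` S \<inter> ?X |S. S \<in> ?N2}"
  have N_\<Sigma>: "N = {S. S \<subseteq> Y \<and> r -` S \<inter> ?X \<in> \<Sigma>}" unfolding N_def \<Sigma>_def by blast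
  have sf: "sigma_algebra ?X {?f -` S \<inter> ?X |S. S \<in> ?N1}"
    using meas_mapsD(2)[OF m1(1)] m1(2) by (intro sigma_algebra_vimage[of ?Y1]) (auto simp: meas_spaces_def)
  have sg: "sigma_algebra ?X {?g -` S \<inter> ?X |S. S \<in> ?N2}"
    using meas_mapsD(2)[OF m2(1)] m2(2) by (intro sigma_algebra_vimage[of ?Y2]) (auto simp: meas_spaces_def)
  have "sigma_algebra Y N"
    using sigma_algebra_image[OF sigma_algebra_Int[OF sf sg], of r] by (simp only: N_\<Sigma> \<Sigma>_def Y_def)
  moreover have "small elts Y"
    using meas_mapsD(1)[OF m1(1)] e1(2) r small_subset[of ?X Y] by (auto simp: meas_spaces_def Y_def)
  ultimately have YN: "(Y, N) \<in> meas_spaces elts" by (simp add: meas_spaces_def)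
  define q where "q = (X, restrict r ?X, (Y, N))"
  have "restrict r ?X -` B \<inter> ?X \<in> msets X" if "B \<in> N" for B
  proof -
    have "restrict r ?X -` B \<inter> ?X = r -` B \<inter> ?X" by auto
    then show ?thesis using that meas_mapsD(4)[OF m1(1)] e1(2) by (auto simp: N_def)
  qed
  then have q: "q \<in> surjective_meas_maps elts"
    using YN meas_mapsD(1)[OF m1(1)] e1(2)
    by (auto simp: q_def surjective_meas_maps_def meas_maps_def Y_def)
  have pbq: "pb q t = pullback ?X r t" for t
    unfolding pb_def q_def by (simp, rule pullback_cong) simp
  have rY: "r ` ?X \<subseteq> Y" by (simp add: Y_def)
  have "pb q ` terms (cod_sp q) = pb e1 ` terms (cod_sp e1) \<inter> pb e2 ` terms (cod_sp e2)"
  proof (intro equalityI subsetI)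
    fix s assume "s \<in> pb q ` terms (cod_sp q)"
    then obtain t where t: "valid Y N t" "s = pullback ?X r t"
      by (auto simp: pbq) (auto simp: q_def terms_def)
    have b1: "\<And>B. B \<in> N \<Longrightarrow> \<exists>S \<in> ?N1. r -` B \<inter> ?X = ?f -` S \<inter> ?X"
      and b2: "\<And>B. B \<in> N \<Longrightarrow> \<exists>S \<in> ?N2. r -` B \<inter> ?X = ?g -` S \<inter> ?X"
      by (auto simp: N_def)
    obtain t1 where t1: "valid ?Y1 ?N1 t1" "pullback ?X ?f t1 = s"
      using pullback_through[OF m1(2) N1 rY rf b1 t(1)] t(2) by metis
    obtain t2 where t2: "valid ?Y2 ?N2 t2" "pullback ?X ?g t2 = s"
      using pullback_through[OF m2(2) N2 rY rg b2 t(1)] t(2) by metis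
    have "t1 \<in> terms (cod_sp e1)" "t2 \<in> terms (cod_sp e2)" "s = pb e1 t1" "s = pb e2 t2"
      using t1 t2 e1(2) e2(2) by (simp_all add: terms_def pb_def)
    then show "s \<in> pb e1 ` terms (cod_sp e1) \<inter> pb e2 ` terms (cod_sp e2)" by blast
  next
    fix s assume s: "s \<in> pb e1 ` terms (cod_sp e1) \<inter> pb e2 ` terms (cod_sp e2)"
    then obtain t1 where t1: "valid ?Y1 ?N1 t1" "pullback ?X ?f t1 = s"
      using e1(2) by (auto simp: terms_def pb_def)
    obtain t2 where t2: "valid ?Y2 ?N2 t2" "pullback ?X ?g t2 = s"
      using s e2(2) by (auto simp: terms_def pb_def)
    have "s \<in> terms X" using s pb_image[OF m1(1)] e1(2) by auto
    then have "valid ?X (msets X) s" by (simp add: terms_def)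
    from pullback_common[OF this Y_def[symmetric] m1(2) t1 m2(2) t2 sat N_def]
    obtain t where "valid Y N t" "pullback ?X r t = s" .
    then show "s \<in> pb q ` terms (cod_sp q)"
      unfolding pbq by (intro image_eqI[of _ _ t]) (auto simp: q_def terms_def)
  qed
  then show ?thesis by (intro that[OF q]) (simp add: q_def)
qed

section \<open>The form\<close>

lemma Pow_subset_iff: "Pow A \<subseteq> Pow B \<longleftrightarrow> A \<subseteq> B"
  by blast

context grothendieck_universe
begin

lemma code:
  assumes "X \<in> meas_spaces elts"
  shows "inj_on (code elts X) (subspaces (terms X))" "small elts (code elts X ` subspaces (terms X))"
proof -
  have "codable elts (terms X)"
    unfolding terms_def using assms meas_spaces_sets[OF assms]
    by (intro codable_terms) (auto simp: meas_spaces_def)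
  then have "codable elts (subspaces (terms X))"
    by (intro codable_subset[OF codable_Pow[OF codable_Pow]]) (auto simp: subspaces_def)
  then have "\<exists>c. inj_on c (subspaces (terms X)) \<and> small elts (c ` subspaces (terms X))"
    by (simp add: codable_def)
  from someI_ex[OF this]
  show "inj_on (code elts X) (subspaces (terms X))" "small elts (code elts X ` subspaces (terms X))"
    unfolding code_def by blast+
qed

lemma decode_code:
  "X \<in> meas_spaces elts \<Longrightarrow> S \<in> subspaces (terms X) \<Longrightarrow> decode elts X (code elts X S) = S"
  unfolding decode_def by (rule inv_into_f_f[OF code(1)])

lemma Fib_meas_form [simp]: "Fib (meas_form elts) X = fibre (terms X) (code elts X)"
  by (simp add: meas_form_def)

lemma carrier_Fib: "carrier (fibre (terms X) (code elts X)) = code elts X ` subspaces (terms X)"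
  by (simp add: fibre_def)

lemma Dir_code:
  "f \<in> meas_maps elts \<Longrightarrow> S \<in> subspaces (terms (dom_sp f)) \<Longrightarrow>
    Dir (meas_form elts) f (code elts (dom_sp f) S) =
      code elts (cod_sp f) (push (pb f) (terms (cod_sp f)) S)"
  by (simp add: meas_form_def decode_code meas_mapsD)

lemma Inv_code:
  "f \<in> meas_maps elts \<Longrightarrow> T \<in> subspaces (terms (cod_sp f)) \<Longrightarrow>
    Inv (meas_form elts) f (code elts (cod_sp f) T) =
      code elts (dom_sp f) (pull (pb f) (terms (cod_sp f)) (terms (dom_sp f)) T)"
  by (simp add: meas_form_def decode_code meas_mapsD)

section \<open>Kernels and images of measurable maps as subspaces\<close>

definition img :: "'u mmap \<Rightarrow> 'u cterm set set" where
  "img f = push (pb f) (terms (cod_sp f)) (Pow (terms (dom_sp f)))"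

definition ker :: "'u mmap \<Rightarrow> 'u cterm set set" where
  "ker f = Pow (terms (dom_sp f) - pb f ` terms (cod_sp f))"

lemma img_subspace: "img f \<in> subspaces (terms (cod_sp f))"
  unfolding img_def by (rule push_subspace[OF Pow_subspace[OF subset_refl]])

lemma ker_subspace: "ker f \<in> subspaces (terms (dom_sp f))"
  unfolding ker_def by (rule Pow_subspace) blast

lemma Im_meas_form:
  "f \<in> meas_maps elts \<Longrightarrow> Im_cl (Meas elts) (meas_form elts) f = code elts (cod_sp f) (img f)"
  by (simp add: Im_cl_def top_fibre code(1) meas_mapsD Dir_code Pow_subspace img_def)

lemma Ker_meas_form:
  "f \<in> meas_maps elts \<Longrightarrow> Ker_cl (Meas elts) (meas_form elts) f = code elts (dom_sp f) (ker f)"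
  by (simp add: Ker_cl_def bottom_fibre code(1) meas_mapsD Inv_code empty_subspace ker_def
      pull_bot[OF pb_image])

lemma ker_subset_iff:
  assumes "f \<in> meas_maps elts" "g \<in> meas_maps elts" "dom_sp f = dom_sp g"
  shows "ker f \<subseteq> ker g \<longleftrightarrow> pb g ` terms (cod_sp g) \<subseteq> pb f ` terms (cod_sp f)"
proof -
  have "ker f \<subseteq> ker g \<longleftrightarrow> terms (dom_sp g) - pb f ` terms (cod_sp f) \<subseteq> terms (dom_sp g) - pb g ` terms (cod_sp g)"
    unfolding ker_def assms(3) Pow_subset_iff ..
  then show ?thesis using pb_image[OF assms(2)] by blast
qed

lemma img_iff:
  assumes "f \<in> meas_maps elts"
  shows "Q \<in> img f \<longleftrightarrow> Q \<subseteq> terms (cod_sp f) \<and>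
    (\<forall>s \<in> terms (cod_sp f). \<forall>t \<in> terms (cod_sp f). pb f s = pb f t \<longrightarrow> s \<in> Q \<longrightarrow> t \<in> Q)"
  unfolding img_def by (rule push_top_iff[OF pb_image[OF assms]])

text \<open>Since \<open>pb e\<close> is injective, \<open>pb m\<close> and the action of the
  composite identify the same pairs of terms, and these pairs determine the image.\<close>

lemma img_Comp_surjective:
  assumes e: "e \<in> surjective_meas_maps elts" and m: "m \<in> meas_maps elts" "cod_sp e = dom_sp m"
  shows "img (Comp (Meas elts) m e) = img m"
proof -
  have e': "e \<in> meas_maps elts" using e by (simp add: surjective_meas_maps_def)
  have "pb (Comp (Meas elts) m e) s = pb (Comp (Meas elts) m e) t \<longleftrightarrow> pb m s = pb m t"
    if "s \<in> terms (cod_sp m)" "t \<in> terms (cod_sp m)" for s t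
    using that pb_Comp[OF e' m] pb_terms[OF m(1)] inj_on_eq_iff[OF pb_inj[OF e]] m(2) by simp
  then have "Q \<in> img (Comp (Meas elts) m e) \<longleftrightarrow> Q \<in> img m" for Q
    unfolding img_iff[OF m(1)] img_iff[OF Comp_meas_maps[OF e' m]] by simp
  then show ?thesis by blast
qed

text \<open>Since \<open>pb m\<close> is onto, the composite and \<open>e\<close> pull back to the
  same set of terms, and this set determines the kernel.\<close>

lemma ker_Comp_injective_trace:
  assumes m: "m \<in> injective_trace_meas_maps elts" and e: "e \<in> meas_maps elts" "cod_sp e = dom_sp m"
  shows "ker (Comp (Meas elts) m e) = ker e"
proof -
  have m': "m \<in> meas_maps elts" using m by (simp add: injective_trace_meas_maps_def)
  have "pb (Comp (Meas elts) m e) ` terms (cod_sp m) = pb e ` (pb m ` terms (cod_sp m))"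
    unfolding image_image using pb_Comp[OF e(1) m' e(2)] by (intro image_cong) auto
  then show ?thesis unfolding ker_def using pb_surj[OF m] e(2) by simp
qed

text \<open>Order on image clusters is thereby turned into inclusion of point sets, which reduces
  the universal property of embeddings to \<open>injective_trace_factor\<close>.\<close>

lemma img_subset_image:
  assumes m: "m \<in> injective_trace_meas_maps elts" and f: "f \<in> meas_maps elts" "cod_sp f = cod_sp m"
    and sub: "img f \<subseteq> img m"
  shows "fun_of f ` pts (dom_sp f) \<subseteq> fun_of m ` pts (dom_sp m)"
proof (rule ccontr)
  let ?A = "fun_of m ` pts (dom_sp m)" and ?Y = "cod_sp m"
  assume nf: "\<not> fun_of f ` pts (dom_sp f) \<subseteq> ?A"
  have m': "m \<in> meas_maps elts" using m by (simp add: injective_trace_meas_maps_def)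
  \<comment> \<open>These two terms agree on \<open>?A\<close> but on no set that is not contained in \<open>?A\<close>.\<close>
  let ?s = "Base {}" and ?t = "Glue ?A (Base {}) ?A (Base {})"
  have "fun_of f ` pts (dom_sp f) \<subseteq> pts ?Y" using meas_mapsD(3)[OF f(1)] f(2) by simp
  then have "?A \<noteq> pts ?Y" using nf by auto
  then have A: "?A \<subset> pts ?Y" using meas_mapsD(3)[OF m'] by blast
  have "{} \<in> msets ?Y" using meas_mapsD(2)[OF m'] by (simp add: meas_spaces_def sigma_algebra_iff2)
  then have st: "?s \<in> terms ?Y" "?t \<in> terms ?Y" using A by (simp_all add: terms_def)
  have ms: "pb m ?s = pb m ?t" by (simp add: pb_def)
  have fs: "pb f ?s \<noteq> pb f ?t" using nf by (simp add: pb_def)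
  \<comment> \<open>\<open>?Q\<close> is a fibre of \<open>pb f\<close>, hence saturated for it. If
    it were also saturated for \<open>pb m\<close>, it would contain \<open>?t\<close> together with
    \<open>?s\<close>.\<close>
  let ?Q = "{u \<in> terms ?Y. pb f u = pb f ?s}"
  have "?Q \<in> img f" using f by (simp add: img_iff)
  then have "?Q \<in> img m" using sub by blast
  then have "?t \<in> ?Q" using st ms unfolding img_iff[OF m'] by blast
  then show False using fs by simp
qed

lemma le_Fib:
  "X \<in> meas_spaces elts \<Longrightarrow> S \<in> subspaces (terms X) \<Longrightarrow> T \<in> subspaces (terms X) \<Longrightarrow>
    code elts X S \<sqsubseteq>\<^bsub>fibre (terms X) (code elts X)\<^esub> code elts X T \<longleftrightarrow> S \<subseteq> T"
  using le_fibre[OF code(1)] .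

section \<open>The axioms of a form\<close>

lemma orean_form_meas_form: "orean_form (Meas elts) elts (meas_form elts)"
proof (intro orean_form.intro category_Meas orean_form_axioms.intro)
  fix X assume "X \<in> Obj (Meas elts)"
  then have X: "X \<in> meas_spaces elts" by simp
  show "small elts (carrier (Fib (meas_form elts) X))" using code(2)[OF X] by (simp add: carrier_Fib)
  show "Lattice.bounded_lattice (Fib (meas_form elts) X)"
    using bounded_lattice_fibre[OF code(1)[OF X]] by simp
  fix S assume "S \<in> carrier (Fib (meas_form elts) X)"
  then obtain S' where S: "S' \<in> subspaces (terms X)" "S = code elts X S'" by (auto simp: carrier_Fib)
  show "Dir (meas_form elts) (Id (Meas elts) X) S = S"
    using Dir_code[OF Id_meas_maps[OF X]] S
      push_ident[OF subspacesD(1)[OF S(1)] pb_Id[OF X]] by simp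
  show "Inv (meas_form elts) (Id (Meas elts) X) S = S"
    using Inv_code[OF Id_meas_maps[OF X]] S
      pull_ident[OF subspacesD(1)[OF S(1)] pb_Id[OF X]] by simp
next
  fix f X Y assume "f \<in> Hom (Meas elts) X Y"
  then have f: "f \<in> meas_maps elts" and XY: "X = dom_sp f" "Y = cod_sp f" by (auto simp: Hom_Meas)
  note sp = meas_mapsD(1,2)[OF f]
  show dir: "Dir (meas_form elts) f \<in> carrier (Fib (meas_form elts) X) \<rightarrow> carrier (Fib (meas_form elts) Y)"
    using Dir_code[OF f] push_subspace[of _ "terms (dom_sp f)"] by (auto simp: carrier_Fib XY)
  show inv: "Inv (meas_form elts) f \<in> carrier (Fib (meas_form elts) Y) \<rightarrow> carrier (Fib (meas_form elts) X)"
    using Inv_code[OF f] pull_subspace[of _ "terms (cod_sp f)"] by (auto simp: carrier_Fib XY)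
  have po: "weak_partial_order (Fib (meas_form elts) Z)" if "Z \<in> meas_spaces elts" for Z
    using partial_order_fibre[OF code(1)[OF that]] by (simp add: partial_order.axioms(1))
  show "isotone (Fib (meas_form elts) X) (Fib (meas_form elts) Y) (Dir (meas_form elts) f)"
    using po sp push_mono[of _ _ "pb f"]
    by (intro isotoneI) (auto simp: XY carrier_Fib Dir_code[OF f] le_Fib push_subspace)
  show "isotone (Fib (meas_form elts) Y) (Fib (meas_form elts) X) (Inv (meas_form elts) f)"
    using po sp pull_mono[of _ _ "pb f"]
    by (intro isotoneI) (auto simp: XY carrier_Fib Inv_code[OF f] le_Fib pull_subspace)
  fix S T assume "S \<in> carrier (Fib (meas_form elts) X)" "T \<in> carrier (Fib (meas_form elts) Y)"
  then obtain S' T' where ST: "S' \<in> subspaces (terms X)" "S = code elts X S'"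
      "T' \<in> subspaces (terms Y)" "T = code elts Y T'" by (auto simp: carrier_Fib)
  show "Dir (meas_form elts) f S \<sqsubseteq>\<^bsub>Fib (meas_form elts) Y\<^esub> T \<longleftrightarrow>
      S \<sqsubseteq>\<^bsub>Fib (meas_form elts) X\<^esub> Inv (meas_form elts) f T"
    using ST sp push_subset_iff[OF subspacesD(1)[OF ST(1)]]
    by (simp add: XY Dir_code[OF f] Inv_code[OF f] le_Fib push_subspace pull_subspace)
next
  fix f g X Y Z
  assume "f \<in> Hom (Meas elts) X Y" "g \<in> Hom (Meas elts) Y Z"
  then have f: "f \<in> meas_maps elts" and g: "g \<in> meas_maps elts" and
    XYZ: "X = dom_sp f" "Y = cod_sp f" "Z = cod_sp g" "cod_sp f = dom_sp g" by (auto simp: Hom_Meas)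
  note gf = Comp_meas_maps[OF f g XYZ(4)]
  have im: "pb g ` terms Z \<subseteq> terms Y" using pb_image[OF g] XYZ by simp
  have cmp: "\<And>t. t \<in> terms Z \<Longrightarrow> pb (Comp (Meas elts) g f) t = pb f (pb g t)"
    using pb_Comp[OF f g XYZ(4)] XYZ(3) by simp
  have push: "push (pb (Comp (Meas elts) g f)) (terms Z) S = push (pb g) (terms Z) (push (pb f) (terms Y) S)" for S
    by (rule push_comp) (use im cmp in auto)
  have pull: "pull (pb (Comp (Meas elts) g f)) (terms Z) (terms X) T =
      pull (pb f) (terms Y) (terms X) (pull (pb g) (terms Z) (terms Y) T)" for T
    by (rule pull_comp) (use im cmp in auto)
  {
    fix S assume "S \<in> carrier (Fib (meas_form elts) X)"
    then obtain S' where S: "S' \<in> subspaces (terms X)" "S = code elts X S'" by (auto simp: carrier_Fib)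
    show "Dir (meas_form elts) (Comp (Meas elts) g f) S = Dir (meas_form elts) g (Dir (meas_form elts) f S)"
      using S Dir_code[OF gf] Dir_code[OF f] Dir_code[OF g] push_subspace[of S' "terms X"]
        push XYZ by simp
  next
    fix T assume "T \<in> carrier (Fib (meas_form elts) Z)"
    then obtain T' where T: "T' \<in> subspaces (terms Z)" "T = code elts Z T'" by (auto simp: carrier_Fib)
    show "Inv (meas_form elts) (Comp (Meas elts) g f) T = Inv (meas_form elts) f (Inv (meas_form elts) g T)"
      using T Inv_code[OF gf] Inv_code[OF f] Inv_code[OF g] pull_subspace[of T' "terms Z"]
        pull XYZ by simp
  }
qed

section \<open>Quotients are the surjections and embeddings the trace embeddings\<close>

lemma surjective_cancel:
  assumes p: "p \<in> surjective_meas_maps elts"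
    and h: "h \<in> meas_maps elts" "h' \<in> meas_maps elts" "dom_sp h = cod_sp p" "dom_sp h' = cod_sp p"
      "cod_sp h = cod_sp h'"
    and eq: "Comp (Meas elts) h p = Comp (Meas elts) h' p"
  shows "h = h'"
proof (rule meas_map_eqI[OF h(1,2) _ h(5)])
  show "dom_sp h = dom_sp h'" using h(3,4) by simp
  fix y assume "y \<in> pts (dom_sp h)"
  then obtain x where x: "x \<in> pts (dom_sp p)" "y = fun_of p x"
    using p h(3) by (auto simp: surjective_meas_maps_def)
  have "fun_of (Comp (Meas elts) h p) x = fun_of (Comp (Meas elts) h' p) x" using eq by simp
  then show "fun_of h y = fun_of h' y" using x by (simp add: compose_def)
qed

lemma injective_cancel:
  assumes m: "m \<in> injective_trace_meas_maps elts"
    and h: "h \<in> meas_maps elts" "h' \<in> meas_maps elts" "dom_sp h = dom_sp h'" "cod_sp h = dom_sp m"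
      "cod_sp h' = dom_sp m"
    and eq: "Comp (Meas elts) m h = Comp (Meas elts) m h'"
  shows "h = h'"
proof (rule meas_map_eqI[OF h(1,2,3)])
  show "cod_sp h = cod_sp h'" using h(4,5) by simp
  fix x assume x: "x \<in> pts (dom_sp h)"
  have "fun_of (Comp (Meas elts) m h) x = fun_of (Comp (Meas elts) m h') x" using eq by simp
  then have "fun_of m (fun_of h x) = fun_of m (fun_of h' x)" using x h(3) by (simp add: compose_def)
  moreover have "fun_of h x \<in> pts (dom_sp m)" "fun_of h' x \<in> pts (dom_sp m)"
    using x h(3,4,5) meas_mapsD(3)[OF h(1)] meas_mapsD(3)[OF h(2)] by auto
  ultimately show "fun_of h x = fun_of h' x"
    using m by (auto simp: injective_trace_meas_maps_def inj_on_eq_iff)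
qed

text \<open>A quotient \<open>p\<close> and the surjective part \<open>e\<close> of its image
  factorization have equal kernels, so \<open>e\<close> factors as \<open>h\<close> after
  \<open>p\<close>. Both \<open>?mh\<close> and the identity fix \<open>p\<close>, so they coincide
  by uniqueness; hence the inclusion of the image is onto. The converse rests on
  \<open>surjective_factor\<close> and cancellation.\<close>

lemma quotient_iff:
  "is_quotient (Meas elts) (meas_form elts) X K p \<longleftrightarrow>
    p \<in> surjective_meas_maps elts \<and> X = dom_sp p \<and> K = code elts X (ker p)"
proof (intro iffI conjI)
  assume q: "is_quotient (Meas elts) (meas_form elts) X K p"
  then have p: "p \<in> meas_maps elts" and X: "dom_sp p = X" and K: "Ker_cl (Meas elts) (meas_form elts) p = K"
    and univ: "\<And>g. g \<in> meas_maps elts \<Longrightarrow> dom_sp g = X \<Longrightarrow>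
      K \<sqsubseteq>\<^bsub>Fib (meas_form elts) X\<^esub> Ker_cl (Meas elts) (meas_form elts) g \<Longrightarrow>
      \<exists>!h. h \<in> Hom (Meas elts) (cod_sp p) (cod_sp g) \<and> g = Comp (Meas elts) h p"
    by (auto simp: is_quotient_def)
  show "X = dom_sp p" using X by simp
  show "K = code elts X (ker p)" using K Ker_meas_form[OF p] X by simp
  let ?m = "incl (cod_sp p) (fun_of p ` pts (dom_sp p))"
  obtain e where e: "e \<in> surjective_meas_maps elts" "?m \<in> injective_trace_meas_maps elts"
      "dom_sp e = dom_sp p" "cod_sp ?m = cod_sp p" "cod_sp e = dom_sp ?m" and pe: "p = Comp (Meas elts) ?m e"
    using image_factorization[OF grothendieck_universe_axioms p] .
  have e': "e \<in> meas_maps elts" using e by (simp add: surjective_meas_maps_def)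
  have m': "?m \<in> meas_maps elts" using e by (simp add: injective_trace_meas_maps_def)
  note XS = meas_mapsD(1)[OF p, unfolded X]
  have "ker p = ker e" by (subst pe) (rule ker_Comp_injective_trace[OF e(2) e' e(5)])
  then have "Ker_cl (Meas elts) (meas_form elts) e = K"
    using Ker_meas_form[OF e'] Ker_meas_form[OF p] K e(3) by simp
  moreover have KK: "K \<sqsubseteq>\<^bsub>Fib (meas_form elts) X\<^esub> K"
    using K Ker_meas_form[OF p] X XS ker_subspace[of p] by (auto simp: le_Fib)
  ultimately have "K \<sqsubseteq>\<^bsub>Fib (meas_form elts) X\<^esub> Ker_cl (Meas elts) (meas_form elts) e" by simp
  from univ[OF e' trans[OF e(3) X] this]
  obtain h where h: "h \<in> Hom (Meas elts) (cod_sp p) (cod_sp e)" "e = Comp (Meas elts) h p"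
    by (elim ex1E conjE)
  have h': "h \<in> meas_maps elts" "dom_sp h = cod_sp p" "cod_sp h = dom_sp ?m"
    using h(1) e(5) by (simp_all add: Hom_Meas)
  have hp: "h \<in> Hom (Meas elts) (cod_sp p) (dom_sp ?m)" "p \<in> Hom (Meas elts) X (cod_sp p)"
    "?m \<in> Hom (Meas elts) (dom_sp ?m) (cod_sp p)"
    using h' p X m' e(4) by (simp_all add: Hom_Meas)
  let ?mh = "Comp (Meas elts) ?m h" and ?id = "Id (Meas elts) (cod_sp p)"
  have "?mh \<in> Hom (Meas elts) (cod_sp p) (cod_sp p)"
    using category.Comp_Hom[OF category_Meas hp(1,3)] .
  moreover have "p = Comp (Meas elts) ?mh p"
    using category.Comp_assoc[OF category_Meas hp(2,1,3)] pe h(2) by metis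
  moreover have "?id \<in> Hom (Meas elts) (cod_sp p) (cod_sp p)"
    using category.Id_Hom[OF category_Meas] meas_mapsD(2)[OF p] by simp
  moreover have "p = Comp (Meas elts) ?id p"
    using category.Id_Comp[OF category_Meas hp(2)] by simp
  moreover have "K \<sqsubseteq>\<^bsub>Fib (meas_form elts) X\<^esub> Ker_cl (Meas elts) (meas_form elts) p"
    using KK K by simp
  ultimately have mh: "?mh = ?id" using univ[OF p X] by blast
  have "y \<in> fun_of p ` pts (dom_sp p)" if "y \<in> pts (cod_sp p)" for y
  proof -
    have "fun_of ?mh y = y" unfolding mh using that by simp
    then have hy: "y = fun_of ?m (fun_of h y)" using that h'(2) by (simp add: compose_def)
    moreover have "fun_of h y \<in> pts (dom_sp ?m)" using meas_mapsD(3)[OF h'(1)] h'(2,3) that by auto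
    ultimately show ?thesis by (simp add: incl_def)
  qed
  then show "p \<in> surjective_meas_maps elts"
    using p meas_mapsD(3)[OF p] unfolding surjective_meas_maps_def by blast
next
  assume "p \<in> surjective_meas_maps elts \<and> X = dom_sp p \<and> K = code elts X (ker p)"
  then have p: "p \<in> surjective_meas_maps elts" "p \<in> meas_maps elts" and X: "X = dom_sp p"
    and K: "K = Ker_cl (Meas elts) (meas_form elts) p"
    by (auto simp: surjective_meas_maps_def Ker_meas_form)
  have "\<exists>!h. h \<in> Hom (Meas elts) (cod_sp p) (cod_sp g) \<and> g = Comp (Meas elts) h p"
    if g: "g \<in> meas_maps elts" "dom_sp g = X"
      and le: "K \<sqsubseteq>\<^bsub>Fib (meas_form elts) X\<^esub> Ker_cl (Meas elts) (meas_form elts) g" for g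
  proof -
    have "ker p \<subseteq> ker g"
      using le ker_subspace[of p] ker_subspace[of g] g X meas_mapsD(1)[OF p(2)]
      by (simp add: K Ker_meas_form p g le_Fib)
    then have "pb g ` terms (cod_sp g) \<subseteq> pb p ` terms (cod_sp p)"
      using ker_subset_iff[OF p(2) g(1)] g(2) X by simp
    then obtain h where h: "h \<in> meas_maps elts" "dom_sp h = cod_sp p" "cod_sp h = cod_sp g"
        "g = Comp (Meas elts) h p"
      using surjective_factor[OF p(1) g(1)] g(2) X by metis
    have uniq: "h' = h" if "h' \<in> Hom (Meas elts) (cod_sp p) (cod_sp g)" "g = Comp (Meas elts) h' p" for h'
    proof -
      have *: "h' \<in> meas_maps elts" "dom_sp h' = cod_sp p" "cod_sp h' = cod_sp h"
        using that(1) h(3) by (simp_all add: Hom_Meas)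
      show ?thesis
        by (rule surjective_cancel[OF p(1) *(1) h(1) *(2) h(2) *(3) trans[OF that(2)[symmetric] h(4)]])
    qed
    have "h \<in> Hom (Meas elts) (cod_sp p) (cod_sp g)" using h(1,2,3) by (simp add: Hom_Meas)
    from conjI[OF this h(4)] show ?thesis by (rule ex1I) (elim conjE uniq)
  qed
  then show "is_quotient (Meas elts) (meas_form elts) X K p"
    unfolding is_quotient_def normal_def Meas_simps using p(2) X K by blast
qed

text \<open>Dually, the inclusion \<open>?n\<close> of the image of an embedding \<open>m\<close>
  has the same image cluster, so it factors as \<open>m\<close> after some \<open>h\<close>.
  Uniqueness makes \<open>h\<close> a left inverse of \<open>e\<close>, which gives injectivity, and
  measurability of \<open>h\<close> gives the trace condition.\<close>

lemma embedding_iff: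
  "is_embedding (Meas elts) (meas_form elts) X S m \<longleftrightarrow>
    m \<in> injective_trace_meas_maps elts \<and> X = cod_sp m \<and> S = code elts X (img m)"
proof (intro iffI conjI)
  assume q: "is_embedding (Meas elts) (meas_form elts) X S m"
  then have m: "m \<in> meas_maps elts" and X: "cod_sp m = X" and S: "Im_cl (Meas elts) (meas_form elts) m = S"
    and univ: "\<And>f. f \<in> meas_maps elts \<Longrightarrow> cod_sp f = X \<Longrightarrow>
      Im_cl (Meas elts) (meas_form elts) f \<sqsubseteq>\<^bsub>Fib (meas_form elts) X\<^esub> S \<Longrightarrow>
      \<exists>!h. h \<in> Hom (Meas elts) (dom_sp f) (dom_sp m) \<and> f = Comp (Meas elts) m h"
    by (auto simp: is_embedding_def)
  show "X = cod_sp m" using X by simp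
  show "S = code elts X (img m)" using S Im_meas_form[OF m] X by simp
  let ?n = "incl (cod_sp m) (fun_of m ` pts (dom_sp m))"
  obtain e where e: "e \<in> surjective_meas_maps elts" "?n \<in> injective_trace_meas_maps elts"
      "dom_sp e = dom_sp m" "cod_sp ?n = cod_sp m" "cod_sp e = dom_sp ?n" and me: "m = Comp (Meas elts) ?n e"
    using image_factorization[OF grothendieck_universe_axioms m] .
  have e': "e \<in> meas_maps elts" using e by (simp add: surjective_meas_maps_def)
  have n': "?n \<in> meas_maps elts" using e by (simp add: injective_trace_meas_maps_def)
  note XS = meas_mapsD(2)[OF m, unfolded X]
  have "img m = img ?n" by (subst me) (rule img_Comp_surjective[OF e(1) n' e(5)])
  then have "Im_cl (Meas elts) (meas_form elts) ?n = S"
    using Im_meas_form[OF n'] Im_meas_form[OF m] S e(4) by simp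
  moreover have SS: "S \<sqsubseteq>\<^bsub>Fib (meas_form elts) X\<^esub> S"
    using S Im_meas_form[OF m] X XS img_subspace[of m] by (auto simp: le_Fib)
  ultimately have "Im_cl (Meas elts) (meas_form elts) ?n \<sqsubseteq>\<^bsub>Fib (meas_form elts) X\<^esub> S" by simp
  from univ[OF n' trans[OF e(4) X] this]
  obtain h where h: "h \<in> Hom (Meas elts) (dom_sp ?n) (dom_sp m)" "?n = Comp (Meas elts) m h"
    by (elim ex1E conjE)
  have h': "h \<in> meas_maps elts" "dom_sp h = cod_sp e" "cod_sp h = dom_sp m"
    using h(1) e(5) by (simp_all add: Hom_Meas)
  have hp: "e \<in> Hom (Meas elts) (dom_sp m) (cod_sp e)" "h \<in> Hom (Meas elts) (cod_sp e) (dom_sp m)"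
    "m \<in> Hom (Meas elts) (dom_sp m) X"
    using h' m X e' e(3) by (simp_all add: Hom_Meas)
  let ?he = "Comp (Meas elts) h e" and ?id = "Id (Meas elts) (dom_sp m)"
  have "?he \<in> Hom (Meas elts) (dom_sp m) (dom_sp m)"
    using category.Comp_Hom[OF category_Meas hp(1,2)] .
  moreover have "m = Comp (Meas elts) m ?he"
    using category.Comp_assoc[OF category_Meas hp(1,2,3)] me h(2) by metis
  moreover have "?id \<in> Hom (Meas elts) (dom_sp m) (dom_sp m)"
    using category.Id_Hom[OF category_Meas] meas_mapsD(1)[OF m] by simp
  moreover have "m = Comp (Meas elts) m ?id"
    using category.Comp_Id[OF category_Meas hp(3)] by simp
  moreover have "Im_cl (Meas elts) (meas_form elts) m \<sqsubseteq>\<^bsub>Fib (meas_form elts) X\<^esub> S" using SS S by simp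
  ultimately have he: "?he = ?id" using univ[OF m X] by blast
  have he_id: "fun_of h (fun_of e x) = x" if "x \<in> pts (dom_sp m)" for x
  proof -
    have "fun_of ?he x = x" unfolding he using that by simp
    then show ?thesis using that e(3) by (simp add: compose_def)
  qed
  have em: "fun_of e x = fun_of m x" if "x \<in> pts (dom_sp m)" for x
  proof -
    have "fun_of e x \<in> pts (dom_sp ?n)" using meas_mapsD(3)[OF e'] e(3,5) that by auto
    then have "fun_of ?n (fun_of e x) = fun_of e x" by (simp add: incl_def)
    moreover have "fun_of m x = fun_of (Comp (Meas elts) ?n e) x" using me by simp
    ultimately show ?thesis using that e(3) by (simp add: compose_def)
  qed
  have inj: "inj_on (fun_of m) (pts (dom_sp m))"
    using he_id em by (intro inj_on_inverseI[of _ "fun_of h"]) simp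
  have "B \<in> {fun_of m -` C \<inter> pts (dom_sp m) |C. C \<in> msets (cod_sp m)}" if B: "B \<in> msets (dom_sp m)" for B
  proof -
    \<comment> \<open>The preimage of \<open>B\<close> under \<open>h\<close> is measurable in the
      subspace, hence the trace of some measurable \<open>C\<close>; as \<open>h\<close> undoes
      \<open>m\<close>, this \<open>C\<close> pulls back to \<open>B\<close>.\<close>
    have "fun_of h -` B \<inter> pts (dom_sp ?n) \<in> msets (dom_sp ?n)"
      using meas_mapsD(4)[OF h'(1)] h'(2,3) B e(5) by simp
    then obtain C where C: "C \<in> msets (cod_sp m)"
        "fun_of h -` B \<inter> pts (dom_sp ?n) = fun_of m ` pts (dom_sp m) \<inter> C"
      by (auto simp: incl_def)
    have "x \<in> B \<longleftrightarrow> fun_of m x \<in> C" if "x \<in> pts (dom_sp m)" for x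
    proof -
      have "fun_of m x \<in> fun_of h -` B \<inter> pts (dom_sp ?n) \<longleftrightarrow> fun_of m x \<in> fun_of m ` pts (dom_sp m) \<inter> C"
        by (simp only: C(2))
      then show ?thesis using that he_id[OF that] em[OF that] by (simp add: incl_def)
    qed
    moreover have "B \<subseteq> pts (dom_sp m)" using B meas_spaces_sets[OF meas_mapsD(1)[OF m]] by auto
    ultimately have "B = fun_of m -` C \<inter> pts (dom_sp m)" by auto
    then show ?thesis using C(1) by blast
  qed
  then have "msets (dom_sp m) = {fun_of m -` C \<inter> pts (dom_sp m) |C. C \<in> msets (cod_sp m)}"
    using meas_mapsD(4)[OF m] by blast
  then show "m \<in> injective_trace_meas_maps elts"
    using m inj unfolding injective_trace_meas_maps_def by simp
next
  assume "m \<in> injective_trace_meas_maps elts \<and> X = cod_sp m \<and> S = code elts X (img m)"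
  then have m: "m \<in> injective_trace_meas_maps elts" "m \<in> meas_maps elts" and X: "X = cod_sp m"
    and S: "S = Im_cl (Meas elts) (meas_form elts) m"
    by (auto simp: injective_trace_meas_maps_def Im_meas_form)
  have inj: "inj_on (fun_of m) (pts (dom_sp m))" using m(1) by (simp add: injective_trace_meas_maps_def)
  have "\<exists>!h. h \<in> Hom (Meas elts) (dom_sp f) (dom_sp m) \<and> f = Comp (Meas elts) m h"
    if f: "f \<in> meas_maps elts" "cod_sp f = X"
      and le: "Im_cl (Meas elts) (meas_form elts) f \<sqsubseteq>\<^bsub>Fib (meas_form elts) X\<^esub> S" for f
  proof -
    have "img f \<subseteq> img m"
      using le img_subspace[of m] img_subspace[of f] f X meas_mapsD(2)[OF m(2)]
      by (simp add: S Im_meas_form m f le_Fib)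
    then have "fun_of f ` pts (dom_sp f) \<subseteq> fun_of m ` pts (dom_sp m)"
      using img_subset_image[OF m(1) f(1)] f(2) X by simp
    then obtain h where h: "h \<in> meas_maps elts" "dom_sp h = dom_sp f" "cod_sp h = dom_sp m"
        "f = Comp (Meas elts) m h"
      using injective_trace_factor[OF m(1) f(1)] f(2) X by metis
    have uniq: "h' = h" if "h' \<in> Hom (Meas elts) (dom_sp f) (dom_sp m)" "f = Comp (Meas elts) m h'" for h'
    proof -
      have *: "h' \<in> meas_maps elts" "dom_sp h' = dom_sp h" "cod_sp h' = dom_sp m"
        using that(1) h(2) by (simp_all add: Hom_Meas)
      show ?thesis
        by (rule injective_cancel[OF m(1) *(1) h(1) *(2,3) h(3) trans[OF that(2)[symmetric] h(4)]])
    qed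
    have "h \<in> Hom (Meas elts) (dom_sp f) (dom_sp m)" using h(1,2,3) by (simp add: Hom_Meas)
    from conjI[OF this h(4)] show ?thesis by (rule ex1I) (elim conjE uniq)
  qed
  then show "is_embedding (Meas elts) (meas_form elts) X S m"
    unfolding is_embedding_def conormal_def Meas_simps using m(2) X S by blast
qed

section \<open>Normal and conormal clusters\<close>

lemma ker_surjective:
  assumes "f \<in> meas_maps elts"
  obtains p where "p \<in> surjective_meas_maps elts" "dom_sp p = dom_sp f" "ker p = ker f"
proof -
  let ?m = "incl (cod_sp f) (fun_of f ` pts (dom_sp f))"
  obtain e where e: "e \<in> surjective_meas_maps elts" "?m \<in> injective_trace_meas_maps elts"
      "dom_sp e = dom_sp f" "cod_sp ?m = cod_sp f" "cod_sp e = dom_sp ?m" and fe: "f = Comp (Meas elts) ?m e"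
    using image_factorization[OF grothendieck_universe_axioms assms] .
  have "e \<in> meas_maps elts" using e(1) by (simp add: surjective_meas_maps_def)
  then have "ker f = ker e" by (subst fe) (rule ker_Comp_injective_trace[OF e(2) _ e(5)])
  then show ?thesis using that[OF e(1,3)] by simp
qed

lemma img_incl:
  assumes "f \<in> meas_maps elts"
  shows "img f = img (incl (cod_sp f) (fun_of f ` pts (dom_sp f)))"
proof -
  let ?m = "incl (cod_sp f) (fun_of f ` pts (dom_sp f))"
  obtain e where e: "e \<in> surjective_meas_maps elts" "?m \<in> injective_trace_meas_maps elts"
      "dom_sp e = dom_sp f" "cod_sp ?m = cod_sp f" "cod_sp e = dom_sp ?m" and fe: "f = Comp (Meas elts) ?m e"
    using image_factorization[OF grothendieck_universe_axioms assms] .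
  have "?m \<in> meas_maps elts" using e(2) by (simp add: injective_trace_meas_maps_def)
  then show ?thesis by (subst fe) (rule img_Comp_surjective[OF e(1) _ e(5)])
qed

lemma img_incl_iff:
  assumes "X \<in> meas_spaces elts" "A \<subseteq> pts X"
  shows "Q \<in> img (incl X A) \<longleftrightarrow> Q \<subseteq> terms X \<and>
    (\<forall>s \<in> terms X. \<forall>t \<in> terms X. restr A s = restr A t \<longrightarrow> s \<in> Q \<longrightarrow> t \<in> Q)"
proof -
  have "incl X A \<in> meas_maps elts"
    using incl_trace[OF assms] by (simp add: injective_trace_meas_maps_def)
  moreover have "pb (incl X A) t = restr A t" for t
    unfolding pb_def incl_def by (simp, rule pullback_cong) simp
  moreover have "cod_sp (incl X A) = X" by (simp add: incl_def)
  ultimately show ?thesis by (simp add: img_iff)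
qed

text \<open>Terms \<open>s\<close> and \<open>t\<close> that agree over \<open>A \<inter> B\<close>
  are linked by an interpolant \<open>w\<close> that agrees with \<open>s\<close> over
  \<open>A\<close> and with \<open>t\<close> over \<open>B\<close>; so a set saturated for both
  restrictions contains \<open>t\<close> with \<open>s\<close>. For the other inclusion, restriction
  to \<open>A \<inter> B\<close> factors through both restrictions.\<close>

lemma img_incl_Int:
  assumes X: "X \<in> meas_spaces elts" and A: "A \<subseteq> pts X" and B: "B \<subseteq> pts X"
  shows "img (incl X A) \<inter> img (incl X B) = img (incl X (A \<inter> B))"
proof -
  have AB: "A \<inter> B \<subseteq> pts X" using A by auto
  have restr: "restr C s = restr C t"
    if "restr D s = restr D t" "C \<subseteq> D" "D \<subseteq> pts X" "s \<in> terms X" "t \<in> terms X" for C D s t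
    using that pullback_pullback[of "pts X" "msets X" _ "\<lambda>x. x" C D "\<lambda>x. x"]
    by (simp add: terms_def comp_def) metis
  have "Q \<in> img (incl X A) \<inter> img (incl X B) \<longleftrightarrow> Q \<in> img (incl X (A \<inter> B))" for Q
  proof
    assume Q: "Q \<in> img (incl X A) \<inter> img (incl X B)"
    have "t \<in> Q" if st: "s \<in> terms X" "t \<in> terms X" "restr (A \<inter> B) s = restr (A \<inter> B) t" "s \<in> Q" for s t
    proof -
      obtain w where w: "w \<in> terms X" "restr A w = restr A s" "restr B w = restr B t"
        using glue[of "pts X" "msets X" s t A B] st A B by (auto simp: terms_def)
      then have "w \<in> Q" using Q st unfolding Int_iff img_incl_iff[OF X A] by metis
      then show "t \<in> Q" using Q st w unfolding Int_iff img_incl_iff[OF X B] by metis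
    qed
    moreover have "Q \<subseteq> terms X" using Q by (simp add: img_incl_iff[OF X A])
    ultimately show "Q \<in> img (incl X (A \<inter> B))" unfolding img_incl_iff[OF X AB] by blast
  next
    assume Q: "Q \<in> img (incl X (A \<inter> B))"
    have 1: "restr A s = restr A t \<longrightarrow> restr (A \<inter> B) s = restr (A \<inter> B) t"
      and 2: "restr B s = restr B t \<longrightarrow> restr (A \<inter> B) s = restr (A \<inter> B) t"
      if "s \<in> terms X" "t \<in> terms X" for s t
      using restr[of A s t "A \<inter> B"] restr[of B s t "A \<inter> B"] that A B by auto
    show "Q \<in> img (incl X A) \<inter> img (incl X B)"
      using Q 1 2 unfolding Int_iff img_incl_iff[OF X A] img_incl_iff[OF X B] img_incl_iff[OF X AB]
      by metis
  qed
  then show ?thesis by blast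
qed

lemma normal_iff:
  assumes "X \<in> meas_spaces elts"
  shows "normal (Meas elts) (meas_form elts) X K \<longleftrightarrow>
    (\<exists>p \<in> surjective_meas_maps elts. dom_sp p = X \<and> K = code elts X (ker p))"
proof
  assume "normal (Meas elts) (meas_form elts) X K"
  then obtain f where f: "f \<in> meas_maps elts" "dom_sp f = X" "K = code elts X (ker f)"
    by (auto simp: normal_def Ker_meas_form)
  then show "\<exists>p \<in> surjective_meas_maps elts. dom_sp p = X \<and> K = code elts X (ker p)"
    using ker_surjective[OF f(1)] by metis
next
  assume "\<exists>p \<in> surjective_meas_maps elts. dom_sp p = X \<and> K = code elts X (ker p)"
  then obtain p where p: "p \<in> meas_maps elts" "dom_sp p = X" "K = code elts X (ker p)"
    unfolding surjective_meas_maps_def by blast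
  then have "Ker_cl (Meas elts) (meas_form elts) p = K" by (simp add: Ker_meas_form)
  with p show "normal (Meas elts) (meas_form elts) X K" unfolding normal_def Meas_simps by blast
qed

lemma conormal_iff:
  assumes X: "X \<in> meas_spaces elts"
  shows "conormal (Meas elts) (meas_form elts) X S \<longleftrightarrow>
    (\<exists>A \<subseteq> pts X. S = code elts X (img (incl X A)))"
proof
  assume "conormal (Meas elts) (meas_form elts) X S"
  then obtain f where f: "f \<in> meas_maps elts" "cod_sp f = X" "S = code elts X (img f)"
    by (auto simp: conormal_def Im_meas_form)
  then show "\<exists>A \<subseteq> pts X. S = code elts X (img (incl X A))"
    using img_incl[OF f(1)] meas_mapsD(3)[OF f(1)] by metis
next
  assume "\<exists>A \<subseteq> pts X. S = code elts X (img (incl X A))"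
  then obtain A where A: "A \<subseteq> pts X" "S = code elts X (img (incl X A))" by blast
  have "incl X A \<in> meas_maps elts"
    using incl_trace[OF X A(1)] by (simp add: injective_trace_meas_maps_def)
  moreover have "cod_sp (incl X A) = X" by (simp add: incl_def)
  ultimately show "conormal (Meas elts) (meas_form elts) X S"
    using A(2) unfolding conormal_def by (intro bexI[of _ "incl X A"]) (simp_all add: Im_meas_form)
qed

section \<open>The noetherian axioms\<close>

lemma noetherian_form_meas_form: "noetherian_form (Meas elts) elts (meas_form elts)"
proof (intro noetherian_form.intro orean_form_meas_form noetherian_form_axioms.intro)
  fix f X Y assume "f \<in> Hom (Meas elts) X Y"
  then have f: "f \<in> meas_maps elts" and XY: "X = dom_sp f" "Y = cod_sp f" by (auto simp: Hom_Meas)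
  note sp = meas_mapsD(1,2)[OF f]
  {
    fix S assume "S \<in> carrier (Fib (meas_form elts) X)"
    then obtain S' where S: "S' \<in> subspaces (terms X)" "S = code elts X S'" by (auto simp: carrier_Fib)
    have "pull (pb f) (terms Y) (terms X) (push (pb f) (terms Y) S') = sum_space S' (ker f)"
      using pull_push[OF S(1), of "pb f" "terms Y"] pb_image[OF f] by (simp add: XY ker_def)
    then show "Inv (meas_form elts) f (Dir (meas_form elts) f S) =
        S \<squnion>\<^bsub>Fib (meas_form elts) X\<^esub> Ker_cl (Meas elts) (meas_form elts) f"
      using S sp ker_subspace[of f] push_subspace[OF S(1)]
      by (simp add: XY Dir_code[OF f] Inv_code[OF f] Ker_meas_form[OF f] join_fibre[OF code(1)])
  next
    fix T assume "T \<in> carrier (Fib (meas_form elts) Y)"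
    then obtain T' where T: "T' \<in> subspaces (terms Y)" "T = code elts Y T'" by (auto simp: carrier_Fib)
    have "push (pb f) (terms Y) (pull (pb f) (terms Y) (terms X) T') = T' \<inter> img f"
      by (simp add: push_pull XY img_def)
    then show "Dir (meas_form elts) f (Inv (meas_form elts) f T) =
        T \<sqinter>\<^bsub>Fib (meas_form elts) Y\<^esub> Im_cl (Meas elts) (meas_form elts) f"
      using T sp img_subspace[of f] pull_subspace[OF T(1)]
      by (simp add: XY Dir_code[OF f] Inv_code[OF f] Im_meas_form[OF f] meet_fibre[OF code(1)])
  next
    let ?m = "incl (cod_sp f) (fun_of f ` pts (dom_sp f))"
    obtain e where e: "e \<in> surjective_meas_maps elts" "?m \<in> injective_trace_meas_maps elts"
        "dom_sp e = dom_sp f" "cod_sp ?m = cod_sp f" "cod_sp e = dom_sp ?m" and fe: "f = Comp (Meas elts) ?m e"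
      using image_factorization[OF grothendieck_universe_axioms f] .
    have "e \<in> meas_maps elts" using e(1) by (simp add: surjective_meas_maps_def)
    then have "ker f = ker e" by (subst fe) (rule ker_Comp_injective_trace[OF e(2) _ e(5)])
    then have "is_quotient (Meas elts) (meas_form elts) X (Ker_cl (Meas elts) (meas_form elts) f) e"
      unfolding quotient_iff Ker_meas_form[OF f] using e by (simp add: XY)
    moreover have "is_embedding (Meas elts) (meas_form elts) Y (Im_cl (Meas elts) (meas_form elts) f) ?m"
      unfolding embedding_iff Im_meas_form[OF f] using e img_incl[OF f] by (simp add: XY)
    ultimately show "\<exists>e m. is_quotient (Meas elts) (meas_form elts) X (Ker_cl (Meas elts) (meas_form elts) f) e \<and>
        is_embedding (Meas elts) (meas_form elts) Y (Im_cl (Meas elts) (meas_form elts) f) m \<and>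
        Cod (Meas elts) e = Dom (Meas elts) m \<and> f = Comp (Meas elts) m e"
      using e(5) fe by (intro exI conjI) simp_all
  }
next
  fix X K K' assume "X \<in> Obj (Meas elts)"
  then have X: "X \<in> meas_spaces elts" by simp
  assume "normal (Meas elts) (meas_form elts) X K" "normal (Meas elts) (meas_form elts) X K'"
  then obtain p p' where p: "p \<in> surjective_meas_maps elts" "dom_sp p = X" "K = code elts X (ker p)"
      and p': "p' \<in> surjective_meas_maps elts" "dom_sp p' = X" "K' = code elts X (ker p')"
    by (auto simp: normal_iff[OF X])
  obtain r where r: "r \<in> surjective_meas_maps elts" "dom_sp r = X"
      "pb r ` terms (cod_sp r) = pb p ` terms (cod_sp p) \<inter> pb p' ` terms (cod_sp p')"
    using common_quotient[OF grothendieck_universe_axioms p(1,2) p'(1,2)] .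
  \<comment> \<open>Kernels are power sets of complements, so their sum belongs to the union of the
    complements, which is the complement of the intersection realized by \<open>r\<close>.\<close>
  have "sum_space (ker p) (ker p') = ker r"
    by (simp add: ker_def p(2) p'(2) r(2,3) sum_space_Pow Diff_Int)
  then have "K \<squnion>\<^bsub>Fib (meas_form elts) X\<^esub> K' = code elts X (ker r)"
    using ker_subspace[of p] ker_subspace[of p'] p p' by (simp add: join_fibre[OF code(1)[OF X]])
  then show "normal (Meas elts) (meas_form elts) X (K \<squnion>\<^bsub>Fib (meas_form elts) X\<^esub> K')"
    using r unfolding normal_iff[OF X] by blast
next
  fix X S S' assume "X \<in> Obj (Meas elts)"
  then have X: "X \<in> meas_spaces elts" by simp
  assume "conormal (Meas elts) (meas_form elts) X S" "conormal (Meas elts) (meas_form elts) X S'"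
  then obtain A B where AB: "A \<subseteq> pts X" "S = code elts X (img (incl X A))"
      "B \<subseteq> pts X" "S' = code elts X (img (incl X B))"
    unfolding conormal_iff[OF X] by blast
  have "img (incl X C) \<in> subspaces (terms X)" for C
    using img_subspace[of "incl X C"] by (simp add: incl_def)
  then have "S \<sqinter>\<^bsub>Fib (meas_form elts) X\<^esub> S' = code elts X (img (incl X (A \<inter> B)))"
    using AB by (simp add: meet_fibre[OF code(1)[OF X]] img_incl_Int[OF X])
  then show "conormal (Meas elts) (meas_form elts) X (S \<sqinter>\<^bsub>Fib (meas_form elts) X\<^esub> S')"
    using AB(1) unfolding conormal_iff[OF X] by blast
qed

section \<open>The proper factorization system\<close>

lemma orthogonal_Meas:
  assumes e: "e \<in> surjective_meas_maps elts" and m: "m \<in> injective_trace_meas_maps elts"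
  shows "orthogonal (Meas elts) e m"
  unfolding orthogonal_def
proof (intro ballI impI)
  have e': "e \<in> meas_maps elts" and m': "m \<in> meas_maps elts"
    using e m by (simp_all add: surjective_meas_maps_def injective_trace_meas_maps_def)
  fix u v
  assume "u \<in> Hom (Meas elts) (Dom (Meas elts) e) (Dom (Meas elts) m)"
    "v \<in> Hom (Meas elts) (Cod (Meas elts) e) (Cod (Meas elts) m)"
  then have u: "u \<in> meas_maps elts" "dom_sp u = dom_sp e" "cod_sp u = dom_sp m"
    and v: "v \<in> meas_maps elts" "dom_sp v = cod_sp e" "cod_sp v = cod_sp m"
    by (simp_all add: Hom_Meas)
  assume sq: "Comp (Meas elts) v e = Comp (Meas elts) m u"
  \<comment> \<open>As \<open>e\<close> is onto, the commuting square forces the values of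
    \<open>v\<close> into the image of \<open>m\<close>, so \<open>v\<close> factors through
    \<open>m\<close> and gives the diagonal. Cancelling \<open>m\<close> yields the other triangle,
    cancelling \<open>e\<close> uniqueness.\<close>
  have "fun_of v y \<in> fun_of m ` pts (dom_sp m)" if "y \<in> pts (dom_sp v)" for y
  proof -
    have "y \<in> fun_of e ` pts (dom_sp e)"
      using that e v(2) by (simp add: surjective_meas_maps_def)
    then obtain x where x: "y = fun_of e x" "x \<in> pts (dom_sp e)" by (rule imageE)
    have "fun_of (Comp (Meas elts) v e) x = fun_of (Comp (Meas elts) m u) x" using sq by simp
    then have "fun_of v y = fun_of m (fun_of u x)" using x u(2) by (simp add: compose_def)
    moreover have "fun_of u x \<in> pts (dom_sp m)" using meas_mapsD(3)[OF u(1)] u(2,3) x(2) by auto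
    ultimately show ?thesis by simp
  qed
  then obtain d where d: "d \<in> meas_maps elts" "dom_sp d = dom_sp v" "cod_sp d = dom_sp m"
      "v = Comp (Meas elts) m d"
    using injective_trace_factor[OF m v(1,3)] by blast
  have hom: "e \<in> Hom (Meas elts) (dom_sp e) (cod_sp e)" "d \<in> Hom (Meas elts) (cod_sp e) (dom_sp m)"
      "m \<in> Hom (Meas elts) (dom_sp m) (cod_sp m)"
    using e' m' d v(2) by (simp_all add: Hom_Meas)
  have eq: "Comp (Meas elts) m (Comp (Meas elts) d e) = Comp (Meas elts) m u"
    unfolding category.Comp_assoc[OF category_Meas hom] d(4)[symmetric] by (rule sq)
  have de: "Comp (Meas elts) d e = u"
  proof (rule injective_cancel[OF m _ u(1) _ _ u(3) eq])
    show "Comp (Meas elts) d e \<in> meas_maps elts" using d(2) v(2) by (intro Comp_meas_maps e' d(1)) simp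
    show "dom_sp (Comp (Meas elts) d e) = dom_sp u" "cod_sp (Comp (Meas elts) d e) = dom_sp m"
      using u(2) d(3) by simp_all
  qed
  have uniq: "d' = d" if d': "d' \<in> Hom (Meas elts) (cod_sp e) (dom_sp m)" "Comp (Meas elts) d' e = u" for d'
  proof (rule surjective_cancel[OF e _ d(1) _ _ _ trans[OF d'(2) de[symmetric]]])
    show "d' \<in> meas_maps elts" "dom_sp d' = cod_sp e" "dom_sp d = cod_sp e" "cod_sp d' = cod_sp d"
      using d'(1) d(2,3) v(2) by (simp_all add: Hom_Meas)
  qed
  show "\<exists>!d. d \<in> Hom (Meas elts) (Cod (Meas elts) e) (Dom (Meas elts) m) \<and>
      Comp (Meas elts) d e = u \<and> Comp (Meas elts) m d = v"
    unfolding Meas_simps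
    by (rule ex1I[of _ d], intro conjI hom(2) de d(4)[symmetric]) (elim conjE uniq)
qed

text \<open>The trace condition holds because each measurable set of the domain is the preimage
  under \<open>f\<close> of its own preimage under the measurable inverse.\<close>

lemma iso_Meas:
  assumes "is_iso (Meas elts) f"
  shows "f \<in> surjective_meas_maps elts" "f \<in> injective_trace_meas_maps elts"
proof -
  obtain g where f: "f \<in> meas_maps elts" and g: "g \<in> meas_maps elts" "dom_sp g = cod_sp f" "cod_sp g = dom_sp f"
    and gf: "Comp (Meas elts) g f = Id (Meas elts) (dom_sp f)"
    and fg: "Comp (Meas elts) f g = Id (Meas elts) (cod_sp f)"
    using assms by (auto simp: is_iso_def Hom_Meas)
  have gf': "fun_of g (fun_of f x) = x" if "x \<in> pts (dom_sp f)" for x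
  proof -
    have "fun_of (Comp (Meas elts) g f) x = x" unfolding gf using that by simp
    then show ?thesis using that by (simp add: compose_def)
  qed
  have fg': "fun_of f (fun_of g y) = y" if "y \<in> pts (cod_sp f)" for y
  proof -
    have "fun_of (Comp (Meas elts) f g) y = y" unfolding fg using that by simp
    then show ?thesis using that g(2) by (simp add: compose_def)
  qed
  have "y \<in> fun_of f ` pts (dom_sp f)" if "y \<in> pts (cod_sp f)" for y
    using fg'[OF that, symmetric] meas_mapsD(3)[OF g(1)] g(2,3) that by (intro image_eqI) auto
  then show "f \<in> surjective_meas_maps elts"
    using f meas_mapsD(3)[OF f] unfolding surjective_meas_maps_def by blast
  have "B \<in> {fun_of f -` C \<inter> pts (dom_sp f) |C. C \<in> msets (cod_sp f)}" if B: "B \<in> msets (dom_sp f)" for B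
  proof -
    have gB: "fun_of g -` B \<inter> pts (cod_sp f) \<in> msets (cod_sp f)"
      using meas_mapsD(4)[OF g(1)] g(2,3) B by simp
    have "B \<subseteq> pts (dom_sp f)" using B meas_spaces_sets[OF meas_mapsD(1)[OF f]] by auto
    moreover have "fun_of f x \<in> pts (cod_sp f)" if "x \<in> pts (dom_sp f)" for x
      using meas_mapsD(3)[OF f] that by blast
    ultimately have "B = fun_of f -` (fun_of g -` B \<inter> pts (cod_sp f)) \<inter> pts (dom_sp f)"
      using gf' by auto
    then show ?thesis using gB by blast
  qed
  then have "msets (dom_sp f) = {fun_of f -` C \<inter> pts (dom_sp f) |C. C \<in> msets (cod_sp f)}"
    using meas_mapsD(4)[OF f] by blast
  moreover have "inj_on (fun_of f) (pts (dom_sp f))" using gf' by (rule inj_on_inverseI)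
  ultimately show "f \<in> injective_trace_meas_maps elts"
    using f by (simp add: injective_trace_meas_maps_def)
qed

lemma surjective_Comp:
  assumes "f \<in> surjective_meas_maps elts" "g \<in> surjective_meas_maps elts" "cod_sp f = dom_sp g"
  shows "Comp (Meas elts) g f \<in> surjective_meas_maps elts"
proof -
  have "compose (pts (dom_sp f)) (fun_of g) (fun_of f) ` pts (dom_sp f) =
      fun_of g ` (fun_of f ` pts (dom_sp f))"
    by (auto simp: compose_def image_image)
  then show ?thesis
    using assms Comp_meas_maps[of f elts g] by (simp add: surjective_meas_maps_def)
qed

lemma injective_trace_Comp:
  assumes f: "f \<in> injective_trace_meas_maps elts" and g: "g \<in> injective_trace_meas_maps elts"
    and fg: "cod_sp f = dom_sp g"
  shows "Comp (Meas elts) g f \<in> injective_trace_meas_maps elts"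
proof -
  have f': "f \<in> meas_maps elts" "inj_on (fun_of f) (pts (dom_sp f))"
      "msets (dom_sp f) = {fun_of f -` B \<inter> pts (dom_sp f) |B. B \<in> msets (cod_sp f)}"
    using f by (simp_all add: injective_trace_meas_maps_def)
  have g': "g \<in> meas_maps elts" "inj_on (fun_of g) (pts (dom_sp g))"
      "msets (dom_sp g) = {fun_of g -` B \<inter> pts (dom_sp g) |B. B \<in> msets (cod_sp g)}"
    using g by (simp_all add: injective_trace_meas_maps_def)
  have im: "fun_of f ` pts (dom_sp f) \<subseteq> pts (dom_sp g)" using meas_mapsD(3)[OF f'(1)] fg by simp
  let ?c = "compose (pts (dom_sp f)) (fun_of g) (fun_of f)"
  have "inj_on ?c (pts (dom_sp f))"
    using comp_inj_on[OF f'(2) inj_on_subset[OF g'(2) im]] by (simp add: inj_on_def compose_def)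
  moreover have vim: "?c -` C \<inter> pts (dom_sp f) = fun_of f -` (fun_of g -` C \<inter> pts (dom_sp g)) \<inter> pts (dom_sp f)" for C
    using im by (auto simp: compose_def)
  have "msets (dom_sp f) = {?c -` C \<inter> pts (dom_sp f) |C. C \<in> msets (cod_sp g)}"
    unfolding vim f'(3) fg g'(3) by blast
  ultimately show ?thesis
    using Comp_meas_maps[OF f'(1) g'(1) fg] by (simp add: injective_trace_meas_maps_def)
qed

lemma proper_factorization_system_Meas:
  "proper_factorization_system (Meas elts) (surjective_meas_maps elts) (injective_trace_meas_maps elts)"
  unfolding proper_factorization_system_def
proof (intro conjI ballI impI)
  show "surjective_meas_maps elts \<subseteq> Arr (Meas elts)" "injective_trace_meas_maps elts \<subseteq> Arr (Meas elts)"
    by (auto simp: surjective_meas_maps_def injective_trace_meas_maps_def)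
  show "{f. is_iso (Meas elts) f} \<subseteq> surjective_meas_maps elts"
    "{f. is_iso (Meas elts) f} \<subseteq> injective_trace_meas_maps elts"
    using iso_Meas by blast+
next
  fix f g assume "f \<in> surjective_meas_maps elts" "g \<in> surjective_meas_maps elts"
    "Cod (Meas elts) f = Dom (Meas elts) g"
  then show "Comp (Meas elts) g f \<in> surjective_meas_maps elts" by (simp add: surjective_Comp)
next
  fix f g assume "f \<in> injective_trace_meas_maps elts" "g \<in> injective_trace_meas_maps elts"
    "Cod (Meas elts) f = Dom (Meas elts) g"
  then show "Comp (Meas elts) g f \<in> injective_trace_meas_maps elts" by (simp add: injective_trace_Comp)
next
  fix f assume "f \<in> Arr (Meas elts)"
  then have "f \<in> meas_maps elts" by simp
  from image_factorization[OF grothendieck_universe_axioms this]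
  obtain e where e: "e \<in> surjective_meas_maps elts"
      "incl (cod_sp f) (fun_of f ` pts (dom_sp f)) \<in> injective_trace_meas_maps elts"
      "cod_sp e = dom_sp (incl (cod_sp f) (fun_of f ` pts (dom_sp f)))"
      "f = Comp (Meas elts) (incl (cod_sp f) (fun_of f ` pts (dom_sp f))) e"
    by metis
  show "\<exists>e \<in> surjective_meas_maps elts. \<exists>m \<in> injective_trace_meas_maps elts.
      Cod (Meas elts) e = Dom (Meas elts) m \<and> f = Comp (Meas elts) m e"
    unfolding Meas_simps using e by blast
next
  fix e m assume "e \<in> surjective_meas_maps elts" "m \<in> injective_trace_meas_maps elts"
  then show "orthogonal (Meas elts) e m" by (rule orthogonal_Meas)
next
  fix e assume e: "e \<in> surjective_meas_maps elts"
  then show "is_epi (Meas elts) e"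
    using surjective_cancel[OF e] by (simp add: is_epi_def Hom_Meas surjective_meas_maps_def)
next
  fix m assume m: "m \<in> injective_trace_meas_maps elts"
  then show "is_mono (Meas elts) m"
    using injective_cancel[OF m] by (simp add: is_mono_def Hom_Meas injective_trace_meas_maps_def)
qed

lemma induces_meas_form:
  "induces (Meas elts) (meas_form elts) (surjective_meas_maps elts) (injective_trace_meas_maps elts)"
  unfolding induces_def quotient_iff embedding_iff using proper_factorization_system_Meas by simp

end

theorem corollary4p21:
  fixes elts :: "'u \<Rightarrow> 'u set"
  assumes "grothendieck_universe elts"
  shows "\<exists>F :: ('u mspace, 'u mmap, 'u) form.
           noetherian_form (Meas elts) elts F \<and>
           (\<forall>X \<in> Obj (Meas elts).
              complete_algebraic_lattice (Fib F X) \<and> modular_lattice (Fib F X)) \<and>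
           induces (Meas elts) F (surjective_meas_maps elts) (injective_trace_meas_maps elts)"
proof -
  interpret grothendieck_universe elts by (rule assms)
  show ?thesis
    using noetherian_form_meas_form induces_meas_form
      complete_algebraic_lattice_fibre[OF code(1)] modular_lattice_fibre[OF code(1)]
    by (intro exI[of _ "meas_form elts"]) simp
qed

end
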